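(* Let $\gamma\in[0,1]$. In the adversarial order model of the $\gamma$-prophet inequality, every algorithm has competitive ratio at most $\frac{1}{2-\gamma}$. Furthermore, the single-threshold algorithm which, given an instance $(F_1,\ldots,F_n)$, uses the threshold $\theta$ satisfying $\Pr_{X_1\sim F_1,\ldots,X_n\sim F_n}(\max_{i\in[n]}X_i\le\theta)=\frac{1}{2-\gamma}$ has competitive ratio $\frac{1}{2-\gamma}$.
   Context: The $\gamma$-prophet inequality ($\gamma\in[0,1]$): an instance is a finite tuple $(F_1,\ldots,F_n)$ of known distributions on $[0,\infty)$ with finite expectation; independent values $X_i\sim F_i$ are revealed in the order $X_1,\ldots,X_n$ (adversarial order: the instance and order are arbitrary). An algorithm is an online stopping rule with stopping time $\tau\in\{1,\ldots,n+1\}$ ($\tau=n+1$: never stops); its reward is $\max\{X_\tau,\gamma X_{\tau-1},\ldots,\gamma X_1\}$ (for $\tau=n+1$, $\gamma\max_iX_i$). A single-threshold algorithm with threshold $\theta$ stops at the first value exceeding $\theta$. The competitive ratio is $\inf_I \mathbb{E}[\text{reward}]/\mathbb{E}[\max_iX_i]$ over all instances of all sizes. (Such a threshold exists for continuous distributions; for general distributions the paper uses stochastic tie-breaking.) *)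

theory Defs
  imports "HOL-Probability.Probability"
begin

text \<open>An instance is the list of the laws of the values, in order of arrival. Values are indexed
  from 1, so \<open>X\<^sub>i\<close> is the coordinate \<open>x i\<close> of a point \<open>x\<close> of the product space \<open>value_space I\<close>.\<close>

definition prophet_instance :: "real measure list \<Rightarrow> bool" where
  "prophet_instance I \<longleftrightarrow> I \<noteq> [] \<and>
     (\<forall>F\<in>set I. real_distribution F \<and> (AE x in F. 0 \<le> x) \<and> integrable F (\<lambda>x. x))"

definition continuous_instance :: "real measure list \<Rightarrow> bool" where
  "continuous_instance I \<longleftrightarrow> prophet_instance I \<and> (\<forall>F\<in>set I. \<forall>x. measure F {x} = 0)"

definition value_space :: "real measure list \<Rightarrow> (nat \<Rightarrow> real) measure" where
  "value_space I = (\<Pi>\<^sub>M i\<in>{1..length I}. I ! (i - 1))"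

definition max_value :: "real measure list \<Rightarrow> (nat \<Rightarrow> real) \<Rightarrow> real" where
  "max_value I x = Max (x ` {1..length I})"

definition opt :: "real measure list \<Rightarrow> real" where
  "opt I = (\<integral>x. max_value I x \<partial>value_space I)"

text \<open>Stopping rules may be randomized: besides the values, the rule sees a random seed with law
  \<open>S\<close>, independent of the values. \<open>history S I t\<close> is the sigma-algebra generated by the seed and
  \<open>X\<^sub>1, \<dots>, X\<^sub>t\<close>.\<close>

definition history :: "'s measure \<Rightarrow> real measure list \<Rightarrow> nat \<Rightarrow> ('s \<times> (nat \<Rightarrow> real)) measure" where
  "history S I t = vimage_algebra (space (S \<Otimes>\<^sub>M value_space I))
     (\<lambda>(s, x). (s, restrict x {1..length (take t I)})) (S \<Otimes>\<^sub>M value_space (take t I))"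

definition stopping_rule ::
    "'s measure \<Rightarrow> real measure list \<Rightarrow> ('s \<times> (nat \<Rightarrow> real) \<Rightarrow> nat) \<Rightarrow> bool" where
  "stopping_rule S I \<tau> \<longleftrightarrow> stopping_time (history S I) \<tau> \<and>
     \<tau> \<in> space (S \<Otimes>\<^sub>M value_space I) \<rightarrow> {1..length I + 1}"

type_synonym 's algorithm = "real measure list \<Rightarrow> 's measure \<times> ('s \<times> (nat \<Rightarrow> real) \<Rightarrow> nat)"

definition online_algorithm :: "'s algorithm \<Rightarrow> bool" where
  "online_algorithm A \<longleftrightarrow> (\<forall>I. prophet_instance I \<longrightarrow>
     prob_space (fst (A I)) \<and> stopping_rule (fst (A I)) I (snd (A I)))"

definition reward :: "real \<Rightarrow> real measure list \<Rightarrow> nat \<Rightarrow> (nat \<Rightarrow> real) \<Rightarrow> real" where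
  "reward \<gamma> I t x =
     (if t \<le> length I then Max (insert (x t) ((\<lambda>j. \<gamma> * x j) ` {1..<t})) else \<gamma> * max_value I x)"

definition expected_reward :: "real \<Rightarrow> 's algorithm \<Rightarrow> real measure list \<Rightarrow> real" where
  "expected_reward \<gamma> A I =
     (\<integral>\<omega>. reward \<gamma> I (snd (A I) \<omega>) (snd \<omega>) \<partial>(fst (A I) \<Otimes>\<^sub>M value_space I))"

text \<open>The ratio is undefined (0/0) when all values vanish almost surely; such instances are left
  out of the infimum.\<close>

definition competitive_ratio :: "real \<Rightarrow> real measure list set \<Rightarrow> 's algorithm \<Rightarrow> real" where
  "competitive_ratio \<gamma> \<I> A = (INF I\<in>{I \<in> \<I>. 0 < opt I}. expected_reward \<gamma> A I / opt I)"

text \<open>Thresholds are extended reals: for \<open>\<gamma> = 1\<close> the threshold has to be \<open>\<infinity>\<close> if the maximum is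
  unbounded.\<close>

definition single_threshold :: "(real measure list \<Rightarrow> ereal) \<Rightarrow> unit algorithm" where
  "single_threshold \<theta> = (\<lambda>I. (return (count_space UNIV) (),
     \<lambda>(_, x). Min (insert (length I + 1) {i \<in> {1..length I}. \<theta> I < ereal (x i)})))"

text \<open>Stochastic tie-breaking: each value carries an independent uniform mark, and
  (value, mark) pairs are compared lexicographically with the threshold \<open>(\<theta>, u)\<close>. Thus a value
  equal to \<open>\<theta>\<close> is accepted with probability \<open>1 - u\<close>.\<close>

definition exceeds :: "ereal \<times> real \<Rightarrow> real \<Rightarrow> real \<Rightarrow> bool" where
  "exceeds \<theta>u y v \<longleftrightarrow> fst \<theta>u < ereal y \<or> (fst \<theta>u = ereal y \<and> snd \<theta>u < v)"

definition marks :: "real measure list \<Rightarrow> (nat \<Rightarrow> real) measure" where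
  "marks I = (\<Pi>\<^sub>M i\<in>{1..length I}. uniform_measure lborel {0..1})"

definition single_threshold_ties ::
    "(real measure list \<Rightarrow> ereal \<times> real) \<Rightarrow> (nat \<Rightarrow> real) algorithm" where
  "single_threshold_ties \<theta>u = (\<lambda>I. (marks I,
     \<lambda>(v, x). Min (insert (length I + 1) {i \<in> {1..length I}. exceeds (\<theta>u I) (x i) (v i)})))"

definition balanced_threshold :: "real \<Rightarrow> real measure list \<Rightarrow> ereal \<Rightarrow> bool" where
  "balanced_threshold \<gamma> I \<theta> \<longleftrightarrow> \<P>(x in value_space I. ereal (max_value I x) \<le> \<theta>) = 1 / (2 - \<gamma>)"

definition balanced_threshold_ties :: "real \<Rightarrow> real measure list \<Rightarrow> ereal \<times> real \<Rightarrow> bool" where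
  "balanced_threshold_ties \<gamma> I \<theta>u \<longleftrightarrow> snd \<theta>u \<in> {0..1} \<and>
     \<P>(\<omega> in marks I \<Otimes>\<^sub>M value_space I. \<forall>i\<in>{1..length I}. \<not> exceeds \<theta>u (snd \<omega> i) (fst \<omega> i)) = 1 / (2 - \<gamma>)"

end

theory Submission
  imports Defs "HOL-Real_Asymp.Real_Asymp"
begin

text \<open>Lower bound: a threshold rule that accepts nothing with probability \<open>q\<close> reaches every value with
  probability at least \<open>q\<close>. It collects the threshold \<open>t\<close> whenever it stops, the excess
  \<open>(X\<^sub>i - t)\<^sup>+\<close> of each value it reaches, and \<open>\<gamma>\<close> times the maximum if it never stops; \<open>q = 1 / (2 - \<gamma>)\<close>
  balances these against the bound of the maximum by \<open>t\<close> plus the sum of the excesses.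

  Upper bound: let a value close to 1 be followed by a huge one of tiny probability and mean about
  \<open>1 - \<gamma>\<close>. Stopping at the first value and waiting for the second both yield about 1, while the
  expected maximum is about \<open>2 - \<gamma>\<close>. All laws involved can be taken without atoms.\<close>

section \<open>The space of seeds and values\<close>

text \<open>Where \<open>q\<close> comes from: write \<open>A\<close> for the sum of the expected
  excesses. In the extreme case, where the maximum equals \<open>t\<close> whenever nothing is
  accepted, the maximum has mean at most \<open>t + A\<close> and the reward mean at least
  \<open>(1 - q + \<gamma> * q) * t + q * A\<close>; both coefficients are \<open>q\<close> exactly
  for \<open>q = 1 / (2 - \<gamma>)\<close>. The absence of atoms shapes the upper bound, since the
  usual two-point law for the rare huge value is excluded. Its substitute is
  \<open>c * U ^ (2 * m)\<close> with \<open>U\<close> uniform on [0,1] and \<open>c\<close> about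
  \<open>(1 - \<gamma>) * (2 * m + 1)\<close>: its mean stays near \<open>1 - \<gamma>\<close>,
  while the mean of its square root is \<open>sqrt c / (m + 1)\<close> and vanishes. The root
  measures how far the value is from being rare and huge, because
  \<open>max x z \<ge> x + z - sqrt z\<close> for \<open>x \<le> 1\<close> and
  \<open>z \<ge> 0\<close>; the even exponent makes it a monomial. The bounds obtained give
  \<open>1 / (2 - \<gamma>)\<close> only in the limit of large \<open>m\<close>. Independence enters
  both bounds in one form: a decision made before \<open>X_i\<close> is a function unaffected by
  overwriting coordinate \<open>i\<close>, so Fubini factors it off.\<close>

declare One_nat_def [simp del]

locale prophet =
  fixes I :: "real measure list"
  assumes prophet_instance: "prophet_instance I"
begin

abbreviation "law i \<equiv> I ! (i - 1)"

lemma law_in_set: "i \<in> {1..length I} \<Longrightarrow> law i \<in> set I"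
  by (intro nth_mem) auto

lemma length_pos: "1 \<le> length I"
  using prophet_instance by (cases I) (auto simp: prophet_instance_def)

lemma
  assumes "i \<in> {1..length I}"
  shows real_distribution_law: "real_distribution (law i)"
    and prob_space_law: "prob_space (law i)"
    and sets_law: "sets (law i) = sets borel"
    and AE_law_nonneg: "AE y in law i. 0 \<le> y"
    and integrable_law: "integrable (law i) (\<lambda>y. y)"
proof -
  show *: "real_distribution (law i)" "AE y in law i. 0 \<le> y" "integrable (law i) (\<lambda>y. y)"
    using prophet_instance law_in_set[OF assms] by (auto simp: prophet_instance_def)
  show "prob_space (law i)" "sets (law i) = sets borel"
    using *(1) by (auto simp: real_distribution_def real_distribution_axioms_def)
qed

text \<open>The product locales demand a probability measure at every index, also outside \<open>{1..length I}\<close>.\<close>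

definition ext_law :: "nat \<Rightarrow> real measure" where
  "ext_law i = (if i \<in> {1..length I} then law i else return borel 0)"

lemma sets_ext_law [simp, measurable_cong]: "sets (ext_law i) = sets borel"
  using sets_law by (auto simp: ext_law_def)

lemma space_ext_law [simp]: "space (ext_law i) = UNIV"
  using sets_eq_imp_space_eq[OF sets_ext_law] by simp

lemma value_space_eq: "value_space I = Pi\<^sub>M {1..length I} ext_law"
  unfolding value_space_def by (rule PiM_cong) (auto simp: ext_law_def)

lemma prob_space_ext_law: "prob_space (ext_law i)"
  unfolding ext_law_def by (auto intro: prob_space_law prob_space_return simp del: One_nat_def)

sublocale ext: product_prob_space ext_law "{1..length I}"
  by (rule product_prob_spaceI) (rule prob_space_ext_law)

lemma prob_space_value_space: "prob_space (value_space I)"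
  unfolding value_space_eq by (rule ext.prob_space_axioms)

lemma measurable_coord [measurable]: "i \<in> {1..length I} \<Longrightarrow> (\<lambda>x. x i) \<in> borel_measurable (value_space I)"
  unfolding value_space_eq by (subst measurable_cong_sets[OF refl sets_ext_law[symmetric]])
    (rule measurable_component_singleton)

lemma measurable_max_value [measurable]: "max_value I \<in> borel_measurable (value_space I)"
  unfolding max_value_def[abs_def] by (rule borel_measurable_Max) auto

end

section \<open>Integrals over seeds and values, and independence of one value from the rest\<close>

locale seeded_prophet = prophet I + S: prob_space S for I and S :: "'s measure"
begin

abbreviation "joint \<equiv> S \<Otimes>\<^sub>M value_space I"

sublocale joint: prob_space joint
  by (intro prob_space_pair S.prob_space_axioms prob_space_value_space)

lemma measurable_joint_coord [measurable]:
  "i \<in> {1..length I} \<Longrightarrow> (\<lambda>\<omega>. snd \<omega> i) \<in> borel_measurable joint"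
  by measurable

lemma distr_joint_snd: "distr joint (value_space I) snd = value_space I"
proof (rule measure_eqI)
  interpret V: prob_space "value_space I" by (rule prob_space_value_space)
  fix B assume "B \<in> sets (distr joint (value_space I) snd)"
  then have B: "B \<in> sets (value_space I)" by simp
  have "snd -` B \<inter> space joint = space S \<times> B"
    using sets.sets_into_space[OF B] by (auto simp: space_pair_measure)
  then show "emeasure (distr joint (value_space I) snd) B = emeasure (value_space I) B"
    using B by (simp add: emeasure_distr V.emeasure_pair_measure_Times S.emeasure_space_1)
qed simp

lemma distr_joint_coord:
  assumes i: "i \<in> {1..length I}"
  shows "distr joint (law i) (\<lambda>\<omega>. snd \<omega> i) = law i"
proof -
  have m: "(\<lambda>x. x i) \<in> value_space I \<rightarrow>\<^sub>M law i"
    using measurable_coord[OF i] by (simp add: measurable_cong_sets[OF refl sets_law[OF i]])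
  have "distr (distr joint (value_space I) snd) (law i) (\<lambda>x. x i) = distr joint (law i) (\<lambda>\<omega>. snd \<omega> i)"
    by (subst distr_distr) (use m in \<open>auto simp: comp_def\<close>)
  moreover have "distr (value_space I) (law i) (\<lambda>x. x i) = law i"
    unfolding value_space_def by (rule distr_PiM_component) (use i prob_space_law in auto)
  ultimately show ?thesis by (simp add: distr_joint_snd)
qed

lemma
  assumes i: "i \<in> {1..length I}"
  shows integrable_coord_iff: "f \<in> borel_measurable borel \<Longrightarrow>
      integrable joint (\<lambda>\<omega>. f (snd \<omega> i) :: real) \<longleftrightarrow> integrable (law i) f"
    and integral_coord: "f \<in> borel_measurable borel \<Longrightarrow> (\<integral>\<omega>. f (snd \<omega> i) \<partial>joint) = (\<integral>y. f y \<partial>law i)"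
    and AE_coord: "(AE y in law i. Q y) \<Longrightarrow> AE \<omega> in joint. Q (snd \<omega> i)"
proof -
  have m: "(\<lambda>\<omega>. snd \<omega> i) \<in> joint \<rightarrow>\<^sub>M law i"
    using measurable_joint_coord[OF i] by (simp add: measurable_cong_sets[OF refl sets_law[OF i]])
  show "integrable joint (\<lambda>\<omega>. f (snd \<omega> i) :: real) \<longleftrightarrow> integrable (law i) f"
    "(\<integral>\<omega>. f (snd \<omega> i) \<partial>joint) = (\<integral>y. f y \<partial>law i)" if "f \<in> borel_measurable borel"
    using integrable_distr_eq[OF m, of f] integral_distr[OF m, of f] that
    by (auto simp: distr_joint_coord[OF i] measurable_cong_sets[OF sets_law[OF i] refl])
  show "AE \<omega> in joint. Q (snd \<omega> i)" if "AE y in law i. Q y"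
    by (rule AE_distrD[OF m]) (use that in \<open>subst distr_joint_coord[OF i]\<close>)
qed

lemma integrable_coord: "i \<in> {1..length I} \<Longrightarrow> integrable joint (\<lambda>\<omega>. snd \<omega> i)"
  by (rule integrable_coord_iff[THEN iffD2, of i "\<lambda>y. y"]) (auto intro: integrable_law)

lemma AE_nonneg: "AE \<omega> in joint. \<forall>i\<in>{1..length I}. 0 \<le> snd \<omega> i"
  by (rule AE_finite_allI) (simp, rule AE_coord[OF _ AE_law_nonneg])

text \<open>Integrating out the seed moves the optimum to the space that carries the rewards, so
  that both can be compared pointwise.\<close>

lemma opt_eq: "opt I = (\<integral>\<omega>. max_value I (snd \<omega>) \<partial>joint)"
proof -
  have "(\<integral>x. max_value I x \<partial>distr joint (value_space I) snd) = (\<integral>\<omega>. max_value I (snd \<omega>) \<partial>joint)"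
    by (rule integral_distr) auto
  then show ?thesis by (simp add: opt_def distr_joint_snd)
qed

lemma prob_snd:
  assumes "Measurable.pred (value_space I) Q"
  shows "\<P>(\<omega> in joint. Q (snd \<omega>)) = \<P>(x in value_space I. Q x)"
proof -
  have "measure (distr joint (value_space I) snd) {x \<in> space (value_space I). Q x}
      = measure joint (snd -` {x \<in> space (value_space I). Q x} \<inter> space joint)"
    by (rule measure_distr) (use assms in auto)
  also have "snd -` {x \<in> space (value_space I). Q x} \<inter> space joint = {\<omega> \<in> space joint. Q (snd \<omega>)}"
    by (auto simp: space_pair_measure)
  finally show ?thesis by (simp add: distr_joint_snd)
qed

text \<open>The sum serves as common integrable majorant: it dominates the maximum here and the
  reward at every stopping value later.\<close>

lemma abs_max_value_le: "\<bar>max_value I x\<bar> \<le> (\<Sum>i\<in>{1..length I}. \<bar>x i\<bar>)"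
proof -
  have "max_value I x \<in> x ` {1..length I}"
    unfolding max_value_def using length_pos by (intro Max_in) auto
  then obtain i where "i \<in> {1..length I}" "max_value I x = x i" by auto
  then show ?thesis using member_le_sum[of i "{1..length I}" "\<lambda>i. \<bar>x i\<bar>"] by simp
qed

lemma integrable_max_value: "integrable joint (\<lambda>\<omega>. max_value I (snd \<omega>))"
proof (rule Bochner_Integration.integrable_bound)
  show "integrable joint (\<lambda>\<omega>. \<Sum>i\<in>{1..length I}. \<bar>snd \<omega> i\<bar>)"
    using integrable_coord by auto
  show "AE \<omega> in joint. norm (max_value I (snd \<omega>)) \<le> norm (\<Sum>i\<in>{1..length I}. \<bar>snd \<omega> i\<bar>)"
    using abs_max_value_le by (simp add: sum_nonneg)
qed simp

text \<open>By \<open>inv\<close>, \<open>f\<close> is constant along coordinate \<open>i\<close>.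
  Integrating that coordinate innermost therefore pulls \<open>f\<close> out and leaves the integral
  of \<open>g\<close>; the same computation without \<open>g\<close> gives back the integral of
  \<open>f\<close>, because \<open>law i\<close> has mass 1.\<close>

lemma nn_integral_coord_indep:
  assumes i: "i \<in> {1..length I}"
    and f [measurable]: "f \<in> borel_measurable joint"
    and g [measurable]: "g \<in> borel_measurable borel"
    and inv: "\<And>s x y. s \<in> space S \<Longrightarrow> f (s, x(i := y)) = f (s, x)"
  shows "(\<integral>\<^sup>+\<omega>. f \<omega> * g (snd \<omega> i) \<partial>joint) = (\<integral>\<^sup>+\<omega>. f \<omega> \<partial>joint) * (\<integral>\<^sup>+y. g y \<partial>law i)"
proof -
  let ?J = "{1..length I} - {i}"
  interpret V: prob_space "value_space I" by (rule prob_space_value_space)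
  interpret Li: prob_space "law i" by (rule prob_space_law[OF i])
  have ins: "insert i ?J = {1..length I}" using i by auto
  have ei: "ext_law i = law i" using i by (simp add: ext_law_def)
  have fs [measurable]: "(\<lambda>x. f (s, x)) \<in> borel_measurable (value_space I)" if "s \<in> space S" for s
    using that by measurable
  have gi [measurable]: "(\<lambda>x. g (x i)) \<in> borel_measurable (value_space I)"
    using i by measurable
  have insert: "(\<integral>\<^sup>+x. h x \<partial>value_space I) = (\<integral>\<^sup>+x. (\<integral>\<^sup>+y. h (x(i := y)) \<partial>law i) \<partial>Pi\<^sub>M ?J ext_law)"
    if "h \<in> borel_measurable (value_space I)" for h
    using ext.product_nn_integral_insert[of ?J i h] that
    by (simp add: value_space_eq ins ei del: insert_Diff_single)
  have gl [measurable]: "g \<in> borel_measurable (law i)"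
    by (simp add: measurable_cong_sets[OF sets_law[OF i] refl])
  \<comment> \<open>The outer integral runs over the product without coordinate \<open>i\<close>,
    where measurability of \<open>f\<close> is not given. Filling in the value 0 embeds this product
    into \<open>value_space I\<close>, and \<open>inv\<close> shows that nothing changes.\<close>
  have meas: "(\<lambda>x. f (s, x)) \<in> borel_measurable (Pi\<^sub>M ?J ext_law)" if s: "s \<in> space S" for s
  proof -
    have "(\<lambda>x. f (s, x(i := 0))) \<in> borel_measurable (Pi\<^sub>M ?J ext_law)"
    proof (rule measurable_compose[OF _ fs[OF s]])
      have "(\<lambda>x. x(i := 0)) \<in> Pi\<^sub>M ?J ext_law \<rightarrow>\<^sub>M Pi\<^sub>M (insert i ?J) ext_law"
        by (rule measurable_fun_upd[where J="?J"])
          (auto intro: measurable_const simp del: sets_ext_law)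
      then show "(\<lambda>x. x(i := 0)) \<in> Pi\<^sub>M ?J ext_law \<rightarrow>\<^sub>M value_space I"
        unfolding value_space_eq ins .
    qed
    then show ?thesis using inv[OF s] by simp
  qed
  have "(\<integral>\<^sup>+\<omega>. f \<omega> * g (snd \<omega> i) \<partial>joint) = (\<integral>\<^sup>+s. \<integral>\<^sup>+x. f (s, x) * g (x i) \<partial>value_space I \<partial>S)"
    by (subst V.nn_integral_fst[symmetric]) (use i in auto)
  also have "\<dots> = (\<integral>\<^sup>+s. (\<integral>\<^sup>+x. f (s, x) \<partial>value_space I) * (\<integral>\<^sup>+y. g y \<partial>law i) \<partial>S)"
  proof (rule nn_integral_cong)
    fix s assume s: "s \<in> space S"
    have "(\<integral>\<^sup>+x. f (s, x) * g (x i) \<partial>value_space I)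
        = (\<integral>\<^sup>+x. f (s, x) * (\<integral>\<^sup>+y. g y \<partial>law i) \<partial>Pi\<^sub>M ?J ext_law)"
      by (subst insert) (use s in \<open>auto simp: inv[OF s] nn_integral_cmult\<close>)
    also have "\<dots> = (\<integral>\<^sup>+x. f (s, x) \<partial>Pi\<^sub>M ?J ext_law) * (\<integral>\<^sup>+y. g y \<partial>law i)"
      by (rule nn_integral_multc[OF meas[OF s]])
    also have "(\<integral>\<^sup>+x. f (s, x) \<partial>Pi\<^sub>M ?J ext_law) = (\<integral>\<^sup>+x. f (s, x) \<partial>value_space I)"
      by (subst insert) (use s in \<open>auto simp: inv[OF s] Li.emeasure_space_1\<close>)
    finally show "(\<integral>\<^sup>+x. f (s, x) * g (x i) \<partial>value_space I)
        = (\<integral>\<^sup>+x. f (s, x) \<partial>value_space I) * (\<integral>\<^sup>+y. g y \<partial>law i)" .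
  qed
  also have "\<dots> = (\<integral>\<^sup>+s. \<integral>\<^sup>+x. f (s, x) \<partial>value_space I \<partial>S) * (\<integral>\<^sup>+y. g y \<partial>law i)"
    by (rule nn_integral_multc) measurable
  also have "(\<integral>\<^sup>+s. \<integral>\<^sup>+x. f (s, x) \<partial>value_space I \<partial>S) = (\<integral>\<^sup>+\<omega>. f \<omega> \<partial>joint)"
    by (rule V.nn_integral_fst) simp
  finally show ?thesis .
qed

text \<open>The bounds on \<open>f\<close> make the product dominated by the integrable
  \<open>g (snd \<omega> i)\<close>; with everything nonnegative, the identity then passes from
  \<open>ennreal\<close> to the reals.\<close>

lemma
  fixes f :: "'s \<times> (nat \<Rightarrow> real) \<Rightarrow> real"
  assumes i: "i \<in> {1..length I}"
    and f [measurable]: "f \<in> borel_measurable joint" and f01: "\<And>\<omega>. 0 \<le> f \<omega>" "\<And>\<omega>. f \<omega> \<le> 1"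
    and g [measurable]: "g \<in> borel_measurable borel" and g0: "\<And>y. 0 \<le> g y" and int: "integrable (law i) g"
    and inv: "\<And>s x y. s \<in> space S \<Longrightarrow> f (s, x(i := y)) = f (s, x)"
  shows integrable_coord_indep: "integrable joint (\<lambda>\<omega>. f \<omega> * g (snd \<omega> i))"
    and integral_coord_indep: "(\<integral>\<omega>. f \<omega> * g (snd \<omega> i) \<partial>joint) = (\<integral>\<omega>. f \<omega> \<partial>joint) * (\<integral>y. g y \<partial>law i)"
proof -
  have "integrable joint (\<lambda>\<omega>. g (snd \<omega> i))"
    using integrable_coord_iff[OF i g] int by simp
  then show int_fg: "integrable joint (\<lambda>\<omega>. f \<omega> * g (snd \<omega> i))"
    by (rule Bochner_Integration.integrable_bound)
      (use i f01 g0 in \<open>auto simp: abs_mult mult_left_le_one_le\<close>)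
  have int_f: "integrable joint f"
    by (rule joint.integrable_const_bound[where B=1]) (use f01 in auto)
  have "ennreal (\<integral>\<omega>. f \<omega> * g (snd \<omega> i) \<partial>joint) = (\<integral>\<^sup>+\<omega>. ennreal (f \<omega>) * ennreal (g (snd \<omega> i)) \<partial>joint)"
    by (subst nn_integral_eq_integral[OF int_fg, symmetric]) (auto simp: f01 g0 ennreal_mult)
  also have "\<dots> = (\<integral>\<^sup>+\<omega>. ennreal (f \<omega>) \<partial>joint) * (\<integral>\<^sup>+y. ennreal (g y) \<partial>law i)"
    by (rule nn_integral_coord_indep[OF i, where f="\<lambda>\<omega>. ennreal (f \<omega>)"]) (simp_all add: inv)
  also have "\<dots> = ennreal ((\<integral>\<omega>. f \<omega> \<partial>joint) * (\<integral>y. g y \<partial>law i))"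
    using nn_integral_eq_integral[OF int_f] nn_integral_eq_integral[OF int]
    by (simp add: f01 g0 ennreal_mult)
  finally show "(\<integral>\<omega>. f \<omega> * g (snd \<omega> i) \<partial>joint) = (\<integral>\<omega>. f \<omega> \<partial>joint) * (\<integral>y. g y \<partial>law i)"
    by (subst (asm) ennreal_inj) (auto intro!: mult_nonneg_nonneg simp: f01 g0)
qed

end

section \<open>Threshold rules\<close>

text \<open>With \<open>E i\<close> read as acceptance of arrival \<open>i\<close>, the minimum is
  the stopping time and \<open>n + 1\<close> the outcome of never stopping. The right-hand side
  refers to arrivals up to \<open>t\<close> only, which is what makes it a stopping time.\<close>

lemma Min_insert_Suc_le_iff:
  "Min (insert (n + 1) {i \<in> {1..n}. E i}) \<le> t \<longleftrightarrow> n + 1 \<le> t \<or> (\<exists>i\<in>{1..n}. i \<le> t \<and> E i)" for n t :: nat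
  by (subst Min_le_iff) auto

lemma Min_insert_Suc_bounds:
  "Min (insert (n + 1) {i \<in> {1..n}. E i}) \<in> {1..n + 1}" for n :: nat
proof -
  have "Min (insert (n + 1) {i \<in> {1..n}. E i}) \<in> insert (n + 1) {i \<in> {1..n}. E i}"
    by (rule Min_in) auto
  then show ?thesis by auto
qed

lemma measurable_exceeds [measurable (raw)]:
  assumes [measurable]: "f \<in> borel_measurable M" "g \<in> borel_measurable M"
  shows "Measurable.pred M (\<lambda>\<omega>. exceeds \<theta>u (f \<omega>) (g \<omega>))"
  unfolding exceeds_def by measurable

section \<open>The reward at a fixed stopping value: sign, measurability and majorant\<close>

lemma reward_nonneg:
  assumes "0 \<le> \<gamma>" "t \<in> {1..length I + 1}" "I \<noteq> []" "\<And>i. i \<in> {1..length I} \<Longrightarrow> 0 \<le> x i"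
  shows "0 \<le> reward \<gamma> I t x"
proof (cases "t \<le> length I")
  case True
  then have "0 \<le> x t" using assms by auto
  also have "x t \<le> reward \<gamma> I t x" using True by (auto simp: reward_def)
  finally show ?thesis .
next
  case False
  have "0 \<le> x 1" using assms by (cases I) auto
  also have "x 1 \<le> max_value I x"
    unfolding max_value_def using \<open>I \<noteq> []\<close> by (cases I) (auto intro!: Max_ge)
  finally show ?thesis using False \<open>0 \<le> \<gamma>\<close> by (simp add: reward_def)
qed

context seeded_prophet
begin

lemma measurable_reward:
  assumes "t \<in> {1..length I + 1}"
  shows "(\<lambda>\<omega>. reward \<gamma> I t (snd \<omega>)) \<in> borel_measurable joint"
proof (cases "t \<le> length I")
  case True
  \<comment> \<open>A maximum over an index set that is independent of \<open>x\<close>, with one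
    measurable function per index, is the form in which measurability of finite maxima
    applies.\<close>
  have eq: "reward \<gamma> I t x = Max ((\<lambda>j. if j = t then x j else \<gamma> * x j) ` {1..t})" for x :: "nat \<Rightarrow> real"
  proof -
    have "{1..t} = insert t {1..<t}" using assms by auto
    then have "(\<lambda>j. if j = t then x j else \<gamma> * x j) ` {1..t} = insert (x t) ((\<lambda>j. \<gamma> * x j) ` {1..<t})"
      by (auto simp: image_iff)
    then show ?thesis using True by (simp add: reward_def)
  qed
  show ?thesis unfolding eq using True
    by (intro borel_measurable_Max measurable_If borel_measurable_times) auto
qed (simp add: reward_def)

lemma abs_reward_le:
  assumes "0 \<le> \<gamma>" "\<gamma> \<le> 1" "t \<in> {1..length I + 1}"
  shows "\<bar>reward \<gamma> I t x\<bar> \<le> (\<Sum>i\<in>{1..length I}. \<bar>x i\<bar>)"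
proof -
  have le: "\<bar>\<gamma> * y\<bar> \<le> \<bar>y\<bar>" for y :: real
    using assms mult_left_le_one_le[of "\<bar>y\<bar>" \<gamma>] by (simp add: abs_mult)
  have mem: "\<bar>x i\<bar> \<le> (\<Sum>i\<in>{1..length I}. \<bar>x i\<bar>)" if "i \<in> {1..length I}" for i
    using member_le_sum[of i "{1..length I}" "\<lambda>i. \<bar>x i\<bar>"] that by simp
  show ?thesis
  proof (cases "t \<le> length I")
    case True
    have "Max (insert (x t) ((\<lambda>j. \<gamma> * x j) ` {1..<t})) \<in> insert (x t) ((\<lambda>j. \<gamma> * x j) ` {1..<t})"
      by (rule Max_in) auto
    then consider "reward \<gamma> I t x = x t" | j where "j \<in> {1..<t}" "reward \<gamma> I t x = \<gamma> * x j"
      using True by (auto simp: reward_def)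
    then show ?thesis
    proof cases
      case 1
      then show ?thesis using mem[of t] True assms by auto
    next
      case (2 j)
      then have "\<bar>x j\<bar> \<le> (\<Sum>i\<in>{1..length I}. \<bar>x i\<bar>)" using mem[of j] True by auto
      then show ?thesis using le[of "x j"] 2 by linarith
    qed
  next
    case False
    then have "reward \<gamma> I t x = \<gamma> * max_value I x" by (simp add: reward_def)
    then show ?thesis using le[of "max_value I x"] abs_max_value_le[of x] by linarith
  qed
qed

end

text \<open>Both algorithms are covered at once: \<open>V\<close> reads the marks off the seed, be
  they uniform or trivial. Taking the marks from a general seed leaves the analysis of the reward
  independent of how ties are broken.\<close>

locale threshold_rule = seeded_prophet I S for I and S :: "'s measure" +
  fixes V :: "'s \<Rightarrow> nat \<Rightarrow> real" and \<theta>u :: "ereal \<times> real"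
  assumes measurable_mark [measurable]: "i \<in> {1..length I} \<Longrightarrow> (\<lambda>s. V s i) \<in> borel_measurable S"
begin

definition accepts :: "nat \<Rightarrow> 's \<times> (nat \<Rightarrow> real) \<Rightarrow> bool" where
  "accepts i \<omega> \<longleftrightarrow> exceeds \<theta>u (snd \<omega> i) (V (fst \<omega>) i)"

definition stop :: "'s \<times> (nat \<Rightarrow> real) \<Rightarrow> nat" where
  "stop \<omega> = Min (insert (length I + 1) {i \<in> {1..length I}. accepts i \<omega>})"

lemma stop_le_iff: "stop \<omega> \<le> t \<longleftrightarrow> length I + 1 \<le> t \<or> (\<exists>i\<in>{1..length I}. i \<le> t \<and> accepts i \<omega>)"
  unfolding stop_def by (rule Min_insert_Suc_le_iff)

lemma stop_bounds: "stop \<omega> \<in> {1..length I + 1}"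
  unfolding stop_def by (rule Min_insert_Suc_bounds)

lemma stop_accepts:
  assumes "stop \<omega> \<le> length I"
  shows "accepts (stop \<omega>) \<omega>" and "j \<in> {1..<stop \<omega>} \<Longrightarrow> \<not> accepts j \<omega>"
proof -
  have "stop \<omega> \<in> insert (length I + 1) {i \<in> {1..length I}. accepts i \<omega>}"
    unfolding stop_def by (rule Min_in) auto
  then show "accepts (stop \<omega>) \<omega>" using assms by auto
  show "\<not> accepts j \<omega>" if "j \<in> {1..<stop \<omega>}"
  proof
    assume "accepts j \<omega>"
    then have "stop \<omega> \<le> j" unfolding stop_le_iff using that assms by auto
    then show False using that by auto
  qed
qed

lemma measurable_accepts [measurable]:
  "i \<in> {1..length I} \<Longrightarrow> Measurable.pred joint (accepts i)"
  unfolding accepts_def[abs_def] by measurable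

lemma measurable_stop: "stop \<in> joint \<rightarrow>\<^sub>M count_space {1..length I + 1}"
proof (subst measurable_count_space_eq2_countable)
  show "stop \<in> space joint \<rightarrow> {1..length I + 1} \<and>
    (\<forall>a\<in>{1..length I + 1}. stop -` {a} \<inter> space joint \<in> sets joint)"
  proof (intro conjI ballI)
    show "stop \<in> space joint \<rightarrow> {1..length I + 1}" using stop_bounds by auto
    fix a assume a: "a \<in> {1..length I + 1}"
    have le: "{\<omega> \<in> space joint. stop \<omega> \<le> t} \<in> sets joint" for t
      unfolding stop_le_iff by measurable
    have "stop -` {a} \<inter> space joint
        = {\<omega> \<in> space joint. stop \<omega> \<le> a} - {\<omega> \<in> space joint. stop \<omega> \<le> a - 1}"
      using a by auto
    then show "stop -` {a} \<inter> space joint \<in> sets joint" using le by auto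
  qed
qed

lemma stopping_rule_stop: "stopping_rule S I stop"
  unfolding stopping_rule_def
proof
  show "stop \<in> space joint \<rightarrow> {1..length I + 1}" using stop_bounds by auto
  show "stopping_time (history S I) stop"
  proof
    fix t
    let ?N = "S \<Otimes>\<^sub>M value_space (take t I)"
    let ?r = "\<lambda>(s, x). (s, restrict x {1..length (take t I)})"
    have r: "?r \<in> space joint \<rightarrow> space ?N"
      by (auto simp: space_pair_measure value_space_def space_PiM PiE_iff restrict_def extensional_def)
    have m: "?r \<in> history S I t \<rightarrow>\<^sub>M ?N"
      unfolding history_def by (rule measurable_vimage_algebra1[OF r])
    \<comment> \<open>Acceptance of an arrival \<open>i \<le> t\<close> looks only at the seed and
      at \<open>X_i\<close>, both of which survive the truncation \<open>?r\<close>; it is thus the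
      pullback of an event about the first \<open>t\<close> values.\<close>
    have acc: "Measurable.pred (history S I t) (accepts i)" if i: "i \<in> {1..length I}" "i \<le> t" for i
    proof -
      have law: "take t I ! (i - 1) = law i" using i by auto
      have c: "(\<lambda>x. x i) \<in> borel_measurable (value_space (take t I))"
        unfolding value_space_def
        using measurable_component_singleton[of i "{1..length (take t I)}" "\<lambda>i. take t I ! (i - 1)"] i
        by (simp add: law measurable_cong_sets[OF refl sets_law[OF i(1)]])
      have "Measurable.pred ?N (accepts i)"
        unfolding accepts_def[abs_def] using i c by measurable
      then have "Measurable.pred (history S I t) (\<lambda>\<omega>. accepts i (?r \<omega>))"
        by (rule measurable_compose[OF m])
      moreover have "accepts i (?r \<omega>) = accepts i \<omega>" for \<omega>
        using i by (auto simp: accepts_def split: prod.split)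
      ultimately show ?thesis by simp
    qed
    have "Measurable.pred (history S I t) (\<lambda>\<omega>. length I + 1 \<le> t \<or> (\<exists>i\<in>{i\<in>{1..length I}. i \<le> t}. accepts i \<omega>))"
      by (intro pred_intros_logic pred_intros_finite acc) auto
    moreover have "(\<lambda>\<omega>. length I + 1 \<le> t \<or> (\<exists>i\<in>{i\<in>{1..length I}. i \<le> t}. accepts i \<omega>)) = (\<lambda>\<omega>. stop \<omega> \<le> t)"
      by (auto simp: stop_le_iff)
    ultimately show "Measurable.pred (history S I t) (\<lambda>\<omega>. stop \<omega> \<le> t)" by metis
  qed
qed

lemma integrable_reward_stop:
  assumes "0 \<le> \<gamma>" "\<gamma> \<le> 1"
  shows "integrable joint (\<lambda>\<omega>. reward \<gamma> I (stop \<omega>) (snd \<omega>))"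
proof (rule Bochner_Integration.integrable_bound)
  show "integrable joint (\<lambda>\<omega>. \<Sum>i\<in>{1..length I}. \<bar>snd \<omega> i\<bar>)"
    using integrable_coord by auto
  show "(\<lambda>\<omega>. reward \<gamma> I (stop \<omega>) (snd \<omega>)) \<in> borel_measurable joint"
    by (rule measurable_compose_countable'[OF _ measurable_stop]) (auto intro: measurable_reward)
  show "AE \<omega> in joint. norm (reward \<gamma> I (stop \<omega>) (snd \<omega>)) \<le> norm (\<Sum>i\<in>{1..length I}. \<bar>snd \<omega> i\<bar>)"
    using abs_reward_le[OF assms stop_bounds] by (simp add: sum_nonneg)
qed

text \<open>With \<open>q = 1 / (2 - \<gamma>)\<close>, \<open>a = E[max; no value accepted]\<close> and \<open>A = \<Sum>\<^sub>i E (X\<^sub>i - t)\<^sup>+\<close> the reward is at least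
  \<open>(1 - q) t + q A + \<gamma> a\<close>, because each \<open>X\<^sub>i\<close> is still reached with probability at least \<open>q\<close>, while
  the maximum has expectation at most \<open>(1 - q) t + A + a\<close>. Since \<open>q - \<gamma> = (1 - q)\<^sup>2 / q\<close>, the
  comparison reduces to \<open>a \<le> q t\<close>.\<close>

lemma reward_stop_ge:
  assumes \<gamma>: "0 \<le> \<gamma>" "\<gamma> \<le> 1"
    and balanced: "\<P>(\<omega> in joint. \<forall>i\<in>{1..length I}. \<not> accepts i \<omega>) = 1 / (2 - \<gamma>)"
  shows "opt I / (2 - \<gamma>) \<le> (\<integral>\<omega>. reward \<gamma> I (stop \<omega>) (snd \<omega>) \<partial>joint)"
proof (cases "fst \<theta>u")
  \<comment> \<open>An infinite threshold fixes the outcome. Rejecting everything has probability 1,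
    which forces \<open>\<gamma> = 1\<close>, and then the reward is the maximum. Accepting
    everything would force \<open>1 / (2 - \<gamma>) = 0\<close>.\<close>
  case PInf
  then have no: "\<not> accepts i \<omega>" for i \<omega> by (simp add: accepts_def exceeds_def)
  then have "1 / (2 - \<gamma>) = 1" using balanced joint.prob_space by simp
  then have "\<gamma> = 1" using \<gamma> by (simp add: field_simps)
  moreover have "stop \<omega> = length I + 1" for \<omega> by (simp add: stop_def no)
  ultimately show ?thesis by (simp add: reward_def opt_eq)
next
  case MInf
  then have "accepts i \<omega>" for i \<omega> by (simp add: accepts_def exceeds_def)
  then have "{\<omega> \<in> space joint. \<forall>i\<in>{1..length I}. \<not> accepts i \<omega>} = {}" using length_pos by auto
  then have "1 / (2 - \<gamma>) = 0" using balanced by (simp only: measure_empty)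
  then show ?thesis using \<gamma> by simp
next
  case (real t)
  let ?n = "length I" and ?J = "{1..length I}"
  define pos where "pos y = max 0 (y - t)" for y :: real
  have pos0: "0 \<le> pos y" for y by (simp add: pos_def)
  have [measurable]: "pos \<in> borel_measurable borel" unfolding pos_def[abs_def] by measurable
  \<comment> \<open>A value equal to \<open>t\<close> may go either way, so both inequalities are
    weak. Only these two consequences of the comparison with the threshold relate decisions to
    values below.\<close>
  have acc_ge: "t \<le> snd \<omega> i" if "accepts i \<omega>" for i \<omega>
    using that real by (auto simp: accepts_def exceeds_def)
  have rej_le: "snd \<omega> i \<le> t" if "\<not> accepts i \<omega>" for i \<omega>
    using that real by (auto simp: accepts_def exceeds_def)
  define none where "none \<omega> = (of_bool (\<forall>i\<in>?J. \<not> accepts i \<omega>) :: real)" for \<omega>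
  \<comment> \<open>The range stops before \<open>i\<close>, so that reaching \<open>X_i\<close> is
    independent of the excess of \<open>X_i\<close>.\<close>
  define reach where "reach i \<omega> = (of_bool (\<forall>j\<in>{1..<i}. \<not> accepts j \<omega>) :: real)" for i \<omega>
  define q where "q = 1 / (2 - \<gamma>)"
  let ?M = "\<lambda>\<omega>. max_value I (snd \<omega>)"

  have none_meas [measurable]: "none \<in> borel_measurable joint"
    unfolding none_def[abs_def] of_bool_def by measurable
  have reach_meas [measurable]: "reach i \<in> borel_measurable joint" if "i \<in> ?J" for i
  proof -
    have "Measurable.pred joint (\<lambda>\<omega>. \<forall>j\<in>{1..<i}. \<not> accepts j \<omega>)"
      using that by (intro pred_intros_finite pred_intros_logic measurable_accepts) auto
    then show ?thesis unfolding reach_def[abs_def] of_bool_def by measurable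
  qed
  have int_none: "integrable joint none"
    by (rule joint.integrable_const_bound[where B=1]) (auto simp: none_def)
  have int_reach: "integrable joint (reach i)" if "i \<in> ?J" for i
    by (rule joint.integrable_const_bound[where B=1]) (use that in \<open>auto simp: reach_def\<close>)
  have int_pos: "integrable (law i) pos" if i: "i \<in> ?J" for i
  proof -
    interpret prob_space "law i" by (rule prob_space_law[OF i])
    show ?thesis unfolding pos_def[abs_def] using integrable_law[OF i] by auto
  qed
  have int_pos': "integrable joint (\<lambda>\<omega>. pos (snd \<omega> i))" if "i \<in> ?J" for i
    using integrable_coord_iff[OF that, of pos] int_pos[OF that] by simp
  have int_none_max: "integrable joint (\<lambda>\<omega>. none \<omega> * ?M \<omega>)"
    by (rule Bochner_Integration.integrable_bound[OF integrable_max_value]) (auto simp: none_def)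

  have E_none: "(\<integral>\<omega>. none \<omega> \<partial>joint) = q"
  proof -
    have "(\<integral>\<omega>. none \<omega> \<partial>joint) = (\<integral>\<omega>. indicator {\<omega> \<in> space joint. \<forall>i\<in>?J. \<not> accepts i \<omega>} \<omega> \<partial>joint)"
      by (rule Bochner_Integration.integral_cong) (auto simp: none_def)
    also have "\<dots> = q" using balanced by (simp add: q_def Int_absorb2)
    finally show ?thesis .
  qed
  have E_reach: "q \<le> (\<integral>\<omega>. reach i \<omega> \<partial>joint)" if i: "i \<in> ?J" for i
    unfolding E_none[symmetric]
    by (rule integral_mono[OF int_none int_reach[OF i]]) (use i in \<open>auto simp: none_def reach_def\<close>)
  define A where "A i = (\<integral>y. pos y \<partial>law i)" for i
  have A0: "0 \<le> A i" for i unfolding A_def by (simp add: pos0)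
  have inv: "reach i (s, x(i := y)) = reach i (s, x)" for i s x y
    by (simp add: reach_def accepts_def)
  have int_reach_pos: "integrable joint (\<lambda>\<omega>. reach i \<omega> * pos (snd \<omega> i))" if "i \<in> ?J" for i
    by (rule integrable_coord_indep[OF that reach_meas[OF that] _ _ _ pos0 int_pos[OF that] inv])
      (simp_all add: reach_def)
  have E_reach_pos: "(\<integral>\<omega>. reach i \<omega> * pos (snd \<omega> i) \<partial>joint) = (\<integral>\<omega>. reach i \<omega> \<partial>joint) * A i"
    if "i \<in> ?J" for i
    unfolding A_def
    by (rule integral_coord_indep[OF that reach_meas[OF that] _ _ _ pos0 int_pos[OF that] inv])
      (simp_all add: reach_def)
  note int_intros = Bochner_Integration.integrable_add Bochner_Integration.integrable_diff
    Bochner_Integration.integrable_sum integrable_mult_right integrable_mult_left joint.integrable_const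
    int_none int_reach_pos int_none_max int_pos'
  define a where "a = (\<integral>\<omega>. none \<omega> * ?M \<omega> \<partial>joint)"

  have int_some: "integrable joint (\<lambda>\<omega>. (1 - none \<omega>) * t)" by (intro int_intros)
  have E_some: "(\<integral>\<omega>. (1 - none \<omega>) * t \<partial>joint) = (1 - q) * t"
    using int_none by (simp add: E_none joint.prob_space)
  have int_sum_reach: "integrable joint (\<lambda>\<omega>. \<Sum>i\<in>?J. reach i \<omega> * pos (snd \<omega> i))" by (intro int_intros)
  have E_sum_reach: "(\<integral>\<omega>. (\<Sum>i\<in>?J. reach i \<omega> * pos (snd \<omega> i)) \<partial>joint)
      = (\<Sum>i\<in>?J. (\<integral>\<omega>. reach i \<omega> \<partial>joint) * A i)"
    by (subst Bochner_Integration.integral_sum) (simp_all add: int_reach_pos E_reach_pos)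
  have int_sum_pos: "integrable joint (\<lambda>\<omega>. \<Sum>i\<in>?J. pos (snd \<omega> i))" by (intro int_intros)
  have E_sum_pos: "(\<integral>\<omega>. (\<Sum>i\<in>?J. pos (snd \<omega> i)) \<partial>joint) = (\<Sum>i\<in>?J. A i)"
    by (subst Bochner_Integration.integral_sum) (simp_all add: int_pos' integral_coord A_def)

  have "a \<le> (\<integral>\<omega>. none \<omega> * t \<partial>joint)"
    unfolding a_def
  proof (rule integral_mono[OF int_none_max])
    fix \<omega>
    show "none \<omega> * ?M \<omega> \<le> none \<omega> * t"
      using length_pos rej_le by (auto simp: none_def max_value_def)
  qed (simp add: int_none)
  then have a_le: "a \<le> q * t" by (simp add: E_none)

  have "(\<integral>\<omega>. (1 - none \<omega>) * t + (\<Sum>i\<in>?J. reach i \<omega> * pos (snd \<omega> i)) + \<gamma> * (none \<omega> * ?M \<omega>) \<partial>joint)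
      \<le> (\<integral>\<omega>. reward \<gamma> I (stop \<omega>) (snd \<omega>) \<partial>joint)"
  proof (rule integral_mono[OF _ integrable_reward_stop[OF \<gamma>]])
    fix \<omega>
    show "(1 - none \<omega>) * t + (\<Sum>i\<in>?J. reach i \<omega> * pos (snd \<omega> i)) + \<gamma> * (none \<omega> * ?M \<omega>)
        \<le> reward \<gamma> I (stop \<omega>) (snd \<omega>)"
    proof (cases "stop \<omega> \<le> ?n")
      case True
      let ?k = "stop \<omega>"
      have k: "?k \<in> ?J" using True stop_bounds[of \<omega>] by auto
      have "none \<omega> = 0" using stop_accepts(1)[OF True] k by (auto simp: none_def)
      \<comment> \<open>Only the accepted value contributes: earlier values were rejected and have
        no excess, later ones are not reached. The left-hand side of the comparison thus collapses
        to the accepted value itself.\<close>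
      moreover have "(\<Sum>i\<in>?J. reach i \<omega> * pos (snd \<omega> i)) = (\<Sum>i\<in>{?k}. reach i \<omega> * pos (snd \<omega> i))"
      proof (rule sum.mono_neutral_right)
        show "\<forall>i\<in>?J - {?k}. reach i \<omega> * pos (snd \<omega> i) = 0"
        proof
          fix i assume i: "i \<in> ?J - {?k}"
          consider "i < ?k" | "?k < i" using i by fastforce
          then show "reach i \<omega> * pos (snd \<omega> i) = 0"
          proof cases
            case 1
            then have "snd \<omega> i \<le> t" using stop_accepts(2)[OF True, of i] i rej_le by auto
            then show ?thesis by (simp add: pos_def)
          next
            case 2
            then have "reach i \<omega> = 0" using stop_accepts(1)[OF True] k by (auto simp: reach_def)
            then show ?thesis by simp
          qed
        qed
      qed (use k in auto)
      moreover have "reach ?k \<omega> = 1" using stop_accepts(2)[OF True] by (auto simp: reach_def)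
      moreover have "pos (snd \<omega> ?k) = snd \<omega> ?k - t"
        using acc_ge[OF stop_accepts(1)[OF True]] by (simp add: pos_def)
      moreover have "snd \<omega> ?k \<le> reward \<gamma> I ?k (snd \<omega>)" using True by (auto simp: reward_def)
      ultimately show ?thesis by simp
    next
      case False
      then have rej: "\<not> accepts i \<omega>" if "i \<in> ?J" for i
        using that by (auto simp: stop_le_iff)
      then have "none \<omega> = 1" by (simp add: none_def)
      moreover have "pos (snd \<omega> i) = 0" if "i \<in> ?J" for i
        using rej_le[OF rej[OF that]] by (simp add: pos_def)
      moreover have "reward \<gamma> I (stop \<omega>) (snd \<omega>) = \<gamma> * ?M \<omega>" using False by (simp add: reward_def)
      ultimately show ?thesis by simp
    qed
  qed (intro int_intros)
  also have "(\<integral>\<omega>. (1 - none \<omega>) * t + (\<Sum>i\<in>?J. reach i \<omega> * pos (snd \<omega> i)) + \<gamma> * (none \<omega> * ?M \<omega>) \<partial>joint)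
      = (1 - q) * t + (\<Sum>i\<in>?J. (\<integral>\<omega>. reach i \<omega> \<partial>joint) * A i) + \<gamma> * a"
    by (simp only: Bochner_Integration.integral_add[OF Bochner_Integration.integrable_add[OF int_some int_sum_reach]
          integrable_mult_right[OF int_none_max]] Bochner_Integration.integral_add[OF int_some int_sum_reach]
          integral_mult_right_zero E_some E_sum_reach a_def)
  finally have "(1 - q) * t + (\<Sum>i\<in>?J. (\<integral>\<omega>. reach i \<omega> \<partial>joint) * A i) + \<gamma> * a
      \<le> (\<integral>\<omega>. reward \<gamma> I (stop \<omega>) (snd \<omega>) \<partial>joint)" .
  moreover have "q * (\<Sum>i\<in>?J. A i) \<le> (\<Sum>i\<in>?J. (\<integral>\<omega>. reach i \<omega> \<partial>joint) * A i)"
    unfolding sum_distrib_left by (intro sum_mono mult_right_mono E_reach A0)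
  ultimately have reward: "(1 - q) * t + q * (\<Sum>i\<in>?J. A i) + \<gamma> * a
      \<le> (\<integral>\<omega>. reward \<gamma> I (stop \<omega>) (snd \<omega>) \<partial>joint)" by linarith

  have "opt I \<le> (\<integral>\<omega>. none \<omega> * ?M \<omega> + (1 - none \<omega>) * t + (\<Sum>i\<in>?J. pos (snd \<omega> i)) \<partial>joint)"
    unfolding opt_eq
  proof (rule integral_mono[OF integrable_max_value])
    fix \<omega> :: "'s \<times> (nat \<Rightarrow> real)"
    have sum0: "0 \<le> (\<Sum>i\<in>?J. pos (snd \<omega> i))" by (simp add: sum_nonneg pos0)
    have "snd \<omega> i \<le> t + (\<Sum>i\<in>?J. pos (snd \<omega> i))" if "i \<in> ?J" for i
    proof -
      have "pos (snd \<omega> i) \<le> (\<Sum>i\<in>?J. pos (snd \<omega> i))"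
        by (rule member_le_sum) (use that pos0 in auto)
      then show ?thesis by (simp add: pos_def)
    qed
    then have "?M \<omega> \<le> t + (\<Sum>i\<in>?J. pos (snd \<omega> i))"
      using length_pos by (auto simp: max_value_def)
    \<comment> \<open>If nothing is accepted, the bound is the maximum plus a nonnegative sum;
      otherwise it is the inequality just derived.\<close>
    then show "?M \<omega> \<le> none \<omega> * ?M \<omega> + (1 - none \<omega>) * t + (\<Sum>i\<in>?J. pos (snd \<omega> i))"
      using sum0 by (cases "\<forall>i\<in>?J. \<not> accepts i \<omega>") (auto simp: none_def)
  qed (intro int_intros)
  also have "\<dots> = a + (1 - q) * t + (\<Sum>i\<in>?J. A i)"
    by (simp only: Bochner_Integration.integral_add[OF Bochner_Integration.integrable_add[OF int_none_max int_some]
          int_sum_pos] Bochner_Integration.integral_add[OF int_none_max int_some] E_some E_sum_pos a_def)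
  finally have opt: "opt I \<le> a + (1 - q) * t + (\<Sum>i\<in>?J. A i)" .

  \<comment> \<open>Solving for \<open>\<gamma>\<close> turns the final comparison into an identity
    of rational functions in \<open>q\<close>.\<close>
  have q: "0 < q" "\<gamma> = 2 - 1 / q" using \<gamma> by (auto simp: q_def)
  have "q * opt I \<le> q * (a + (1 - q) * t + (\<Sum>i\<in>?J. A i))"
    using opt q by simp
  also have "\<dots> = (1 - q) * t + q * (\<Sum>i\<in>?J. A i) + \<gamma> * a - (1 - q)\<^sup>2 / q * (q * t - a)"
    using q(1) unfolding q(2) by (simp add: field_simps power2_eq_square)
  also have "\<dots> \<le> (1 - q) * t + q * (\<Sum>i\<in>?J. A i) + \<gamma> * a"
    using a_le q(1) by simp
  also note reward
  finally show ?thesis by (simp add: q_def)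
qed

end

section \<open>Existence of balanced thresholds\<close>

abbreviation unit_uniform :: "real measure" where
  "unit_uniform \<equiv> uniform_measure lborel {0..1}"

lemma prob_space_unit_uniform: "prob_space unit_uniform"
  by (rule prob_space_uniform_measure) auto

lemma unit_uniform_atMost: "u \<in> {0..1} \<Longrightarrow> emeasure unit_uniform {..u} = ennreal u"
  by (subst emeasure_uniform_measure) (auto simp: Int_atLeastAtMostL1 min_def divide_ennreal simp flip: ennreal_1)

context prophet
begin

lemma prob_space_marks: "prob_space (marks I)"
  unfolding marks_def by (rule prob_space_PiM) (rule prob_space_unit_uniform)

lemma measurable_marks_coord [measurable]:
  "i \<in> {1..length I} \<Longrightarrow> (\<lambda>v. v i) \<in> borel_measurable (marks I)"
  unfolding marks_def
  using measurable_component_singleton[of i "{1..length I}" "\<lambda>_. unit_uniform"]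
  by (simp add: measurable_cong_sets[OF refl sets_uniform_measure])

sublocale marks: threshold_rule I "marks I" "\<lambda>v. v" \<theta>u for \<theta>u
  by (intro threshold_rule.intro seeded_prophet.intro threshold_rule_axioms.intro
    prophet_axioms prob_space_marks measurable_marks_coord)

text \<open>Off the threshold the mark has no influence; a tie is rejected when the mark is at most
  \<open>u\<close>, an event of probability \<open>u\<close>.\<close>

lemma nn_integral_unit_not_exceeds:
  assumes "u \<in> {0..1}"
  shows "(\<integral>\<^sup>+v. of_bool (\<not> exceeds (ereal t, u) y v) \<partial>unit_uniform)
    = indicator {..<t} y + ennreal u * indicator {t} y"
proof -
  interpret prob_space unit_uniform by (rule prob_space_unit_uniform)
  consider "y < t" | "y = t" | "t < y" by linarith
  then show ?thesis
  proof cases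
    case 1
    then show ?thesis using emeasure_space_1 by (simp add: exceeds_def)
  next
    case 2
    then have "(\<integral>\<^sup>+v. of_bool (\<not> exceeds (ereal t, u) y v) \<partial>unit_uniform)
        = (\<integral>\<^sup>+v. indicator {..u} v \<partial>unit_uniform)"
      by (intro nn_integral_cong) (auto simp: exceeds_def indicator_def)
    also have "\<dots> = ennreal u" using unit_uniform_atMost[OF assms] by simp
    finally show ?thesis using 2 by simp
  next
    case 3
    then show ?thesis by (simp add: exceeds_def)
  qed
qed

text \<open>For fixed values the marks integrate out factor by factor, leaving the rejection
  probability of each value; the product law of the values then factors in the same way.\<close>

lemma prob_none_accepted_marks:
  assumes u: "u \<in> {0..1}"
  shows "\<P>(\<omega> in marks I \<Otimes>\<^sub>M value_space I. \<forall>i\<in>{1..length I}. \<not> exceeds (ereal t, u) (snd \<omega> i) (fst \<omega> i))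
    = (\<Prod>i\<in>{1..length I}. measure (law i) {..<t} + u * measure (law i) {t})"
proof -
  let ?J = "{1..length I}" and ?P = "marks I \<Otimes>\<^sub>M value_space I"
  let ?ok = "\<lambda>y v. of_bool (\<not> exceeds (ereal t, u) y v) :: ennreal"
  let ?A = "{\<omega> \<in> space ?P. \<forall>i\<in>?J. \<not> exceeds (ereal t, u) (snd \<omega> i) (fst \<omega> i)}"
  interpret V: prob_space "value_space I" by (rule prob_space_value_space)
  interpret W: prob_space "marks I" by (rule prob_space_marks)
  interpret WV: pair_sigma_finite "marks I" "value_space I" by unfold_locales
  interpret U: product_prob_space "\<lambda>_. unit_uniform" ?J
    by (rule product_prob_spaceI) (rule prob_space_unit_uniform)
  have A: "?A \<in> sets ?P" by measurable
  have ok [measurable]: "(\<lambda>v. ?ok y v) \<in> borel_measurable unit_uniform" for y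
  proof -
    have "Measurable.pred unit_uniform (\<lambda>v. exceeds (ereal t, u) y v)"
      by (rule measurable_exceeds) (simp_all add: measurable_ident_sets)
    then show ?thesis unfolding of_bool_def by measurable
  qed
  have prod_eq: "(\<Prod>i\<in>?J. ?ok (x i) (v i)) = of_bool (\<forall>i\<in>?J. \<not> exceeds (ereal t, u) (x i) (v i))" for x v
    by (auto simp: prod_zero_iff)
  have "emeasure ?P ?A = (\<integral>\<^sup>+\<omega>. indicator ?A \<omega> \<partial>?P)" using A by simp
  also have "\<dots> = (\<integral>\<^sup>+x. \<integral>\<^sup>+v. indicator ?A (v, x) \<partial>marks I \<partial>value_space I)"
    by (rule WV.nn_integral_snd[symmetric]) (use A in simp)
  also have "\<dots> = (\<integral>\<^sup>+x. \<integral>\<^sup>+v. (\<Prod>i\<in>?J. ?ok (x i) (v i)) \<partial>marks I \<partial>value_space I)"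
    by (intro nn_integral_cong) (auto simp: prod_eq space_pair_measure indicator_def)
  also have "\<dots> = (\<integral>\<^sup>+x. (\<Prod>i\<in>?J. indicator {..<t} (x i) + ennreal u * indicator {t} (x i)) \<partial>value_space I)"
    unfolding marks_def
    by (subst U.product_nn_integral_prod) (auto simp: nn_integral_unit_not_exceeds[OF u])
  also have "\<dots> = (\<Prod>i\<in>?J. \<integral>\<^sup>+y. indicator {..<t} y + ennreal u * indicator {t} y \<partial>ext_law i)"
    unfolding value_space_eq 
    by (rule ext.product_nn_integral_prod)
      (simp_all add: measurable_cong_sets[OF sets_ext_law refl] borel_measurable_add
        borel_measurable_times_ennreal borel_measurable_indicator borel_measurable_const)
  also have "\<dots> = (\<Prod>i\<in>?J. ennreal (measure (law i) {..<t} + u * measure (law i) {t}))"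
  proof (rule prod.cong)
    fix i assume i: "i \<in> ?J"
    interpret real_distribution "law i" by (rule real_distribution_law[OF i])
    have "ext_law i = law i" using i by (simp add: ext_law_def)
    then show "(\<integral>\<^sup>+y. indicator {..<t} y + ennreal u * indicator {t} y \<partial>ext_law i)
        = ennreal (measure (law i) {..<t} + u * measure (law i) {t})"
      using u by (simp add: nn_integral_add nn_integral_cmult emeasure_eq_measure ennreal_mult)
  qed simp
  also have "\<dots> = ennreal (\<Prod>i\<in>?J. measure (law i) {..<t} + u * measure (law i) {t})"
    using u by (intro prod_ennreal) auto
  finally show ?thesis
    using u by (subst (asm) marks.joint.emeasure_eq_measure, subst (asm) ennreal_inj)
      (auto intro!: prod_nonneg)
qed

text \<open>The event is a box in the product space, so its probability factors.\<close>

lemma prob_max_value_le: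
  "\<P>(x in value_space I. max_value I x \<le> t) = (\<Prod>i\<in>{1..length I}. measure (law i) {..t})"
proof -
  let ?J = "{1..length I}"
  interpret V: prob_space "value_space I" by (rule prob_space_value_space)
  have "{x \<in> space (value_space I). max_value I x \<le> t} = (\<Pi>\<^sub>E i\<in>?J. {..t})"
    using length_pos by (simp add: value_space_eq space_PiM PiE_def max_value_def) auto
  then have "emeasure (value_space I) {x \<in> space (value_space I). max_value I x \<le> t}
      = (\<Prod>i\<in>?J. emeasure (ext_law i) {..t})"
    by (simp add: value_space_eq ext.emeasure_PiM)
  also have "\<dots> = (\<Prod>i\<in>?J. ennreal (measure (law i) {..t}))"
  proof (rule prod.cong)
    fix i assume i: "i \<in> ?J"
    interpret real_distribution "law i" by (rule real_distribution_law[OF i])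
    show "emeasure (ext_law i) {..t} = ennreal (measure (law i) {..t})"
      using i by (simp add: ext_law_def emeasure_eq_measure)
  qed simp
  also have "\<dots> = ennreal (\<Prod>i\<in>?J. measure (law i) {..t})" by (intro prod_ennreal) auto
  finally show ?thesis
    by (subst (asm) V.emeasure_eq_measure, subst (asm) ennreal_inj) (auto intro!: prod_nonneg)
qed

text \<open>The threshold is the \<open>q\<close>-quantile of the maximum; the tie-breaking parameter interpolates
  between the left limit and the value of its distribution function there.\<close>

lemma ex_quantile:
  assumes q: "0 < q" "q < 1"
  obtains t u where "u \<in> {0..1}"
    "(\<Prod>i\<in>{1..length I}. measure (law i) {..<t} + u * measure (law i) {t}) = q"
proof -
  let ?J = "{1..length I}"
  define G where "G t = (\<Prod>i\<in>?J. cdf (law i) t)" for t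
  have rd: "real_distribution (law i)" if "i \<in> ?J" for i by (rule real_distribution_law[OF that])
  have fb: "finite_borel_measure (law i)" if "i \<in> ?J" for i
    using rd[OF that] by (rule real_distribution.finite_borel_measure_M)
  have mono: "G s \<le> G t" if "s \<le> t" for s t
    unfolding G_def using fb that
    by (intro prod_mono) (auto intro: finite_borel_measure.cdf_nondecreasing finite_borel_measure.cdf_nonneg)
  have top: "(G \<longlongrightarrow> 1) at_top"
  proof -
    have "((\<lambda>t. \<Prod>i\<in>?J. cdf (law i) t) \<longlongrightarrow> (\<Prod>i\<in>?J. 1)) at_top"
      by (intro tendsto_prod real_distribution.cdf_lim_at_top_prob rd)
    then show ?thesis by (simp add: G_def[abs_def])
  qed
  have bot: "(G \<longlongrightarrow> 0) at_bot"
  proof -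
    have "((\<lambda>t. \<Prod>i\<in>?J. cdf (law i) t) \<longlongrightarrow> (\<Prod>i\<in>?J. 0)) at_bot"
      by (intro tendsto_prod finite_borel_measure.cdf_lim_at_bot fb)
    \<comment> \<open>A product of zeros vanishes only over a nonempty index set; this is where
      \<open>I \<noteq> []\<close> enters.\<close>
    then show ?thesis using prophet_instance
      by (simp add: G_def[abs_def] power_0_left prophet_instance_def)
  qed
  obtain b where b: "q < G b"
    using order_tendstoD(1)[OF top q(2)] by (auto dest: eventually_happens)
  obtain a where a: "G a < q"
    using order_tendstoD(2)[OF bot q(1)] by (auto dest: eventually_happens)
  define Q where "Q = {t. q \<le> G t}"
  define t where "t = Inf Q"
  have "b \<in> Q" using b by (simp add: Q_def)
  have "a \<le> s" if "s \<in> Q" for s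
    using that a mono[of s a] by (cases "a \<le> s") (auto simp: Q_def)
  then have bdd: "bdd_below Q" by (rule bdd_belowI)
  have above: "q \<le> G s" if s: "t < s" for s
  proof -
    obtain r where "r \<in> Q" "r < s"
      using s \<open>b \<in> Q\<close> bdd unfolding t_def by (subst (asm) cInf_less_iff) auto
    then show ?thesis using mono[of r s] by (auto simp: Q_def)
  qed
  have below: "G s \<le> q" if s: "s < t" for s
    using cInf_lower[OF _ bdd, of s] s unfolding t_def Q_def by fastforce
  define H where "H u = (\<Prod>i\<in>?J. measure (law i) {..<t} + u * measure (law i) {t})" for u :: real
  have "(G \<longlongrightarrow> (\<Prod>i\<in>?J. measure (law i) {..<t})) (at_left t)"
    unfolding G_def[abs_def] by (intro tendsto_prod finite_borel_measure.cdf_at_left fb)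
  then have H0: "H 0 \<le> q"
    using tendsto_upperbound[of G _ "at_left t" q] by (simp add: H_def eventually_at_filter below)
  have "(G \<longlongrightarrow> G t) (at_right t)"
    unfolding G_def[abs_def] using finite_borel_measure.cdf_is_right_cont[OF fb]
    by (intro tendsto_prod) (auto simp: continuous_within)
  then have Gt: "q \<le> G t"
    using tendsto_lowerbound[of G _ "at_right t" q] by (simp add: eventually_at_filter above)
  have "G t = H 1" unfolding G_def H_def
  proof (rule prod.cong)
    fix i assume i: "i \<in> ?J"
    interpret real_distribution "law i" by (rule rd[OF i])
    have "measure (law i) ({..<t} \<union> {t}) = measure (law i) {..<t} + measure (law i) {t}"
      by (rule finite_measure_Union) auto
    moreover have "{..<t} \<union> {t} = {..t}" by auto
    ultimately show "cdf (law i) t = measure (law i) {..<t} + 1 * measure (law i) {t}"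
      by (simp add: cdf_def)
  qed simp
  then have H1: "q \<le> H 1" using Gt by simp
  have "continuous_on {0..1} H" unfolding H_def[abs_def] by (intro continuous_intros)
  then obtain u where "0 \<le> u" "u \<le> 1" "H u = q"
    using IVT'[of H 0 q 1] H0 H1 by auto
  then show ?thesis using that[of u t] by (simp add: H_def)
qed

lemma ex_balanced_threshold_ties:
  assumes \<gamma>: "0 \<le> \<gamma>" "\<gamma> \<le> 1"
  shows "\<exists>\<theta>u. balanced_threshold_ties \<gamma> I \<theta>u"
proof (cases "\<gamma> = 1")
  case True
  \<comment> \<open>For \<open>\<gamma> = 1\<close> the required probability is 1, which no finite
    threshold attains if the maximum is unbounded; the threshold \<open>\<infinity>\<close> rejects
    everything.\<close>
  have "balanced_threshold_ties \<gamma> I (\<infinity>, 0)"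
    using marks.joint.prob_space by (simp add: balanced_threshold_ties_def exceeds_def True)
  then show ?thesis ..
next
  case False
  then have "0 < 1 / (2 - \<gamma>)" "1 / (2 - \<gamma>) < 1" using \<gamma> by auto
  then obtain t u where "u \<in> {0..1}"
      "(\<Prod>i\<in>{1..length I}. measure (law i) {..<t} + u * measure (law i) {t}) = 1 / (2 - \<gamma>)"
    by (rule ex_quantile)
  then have "balanced_threshold_ties \<gamma> I (ereal t, u)"
    unfolding balanced_threshold_ties_def by (subst prob_none_accepted_marks) auto
  then show ?thesis ..
qed

lemma ex_balanced_threshold:
  assumes \<gamma>: "0 \<le> \<gamma>" "\<gamma> \<le> 1" and I: "continuous_instance I"
  shows "\<exists>\<theta>. balanced_threshold \<gamma> I \<theta>"
proof (cases "\<gamma> = 1")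
  case True
  have "balanced_threshold \<gamma> I \<infinity>"
    using prob_space.prob_space[OF prob_space_value_space] by (simp add: balanced_threshold_def True)
  then show ?thesis ..
next
  case False
  then have "0 < 1 / (2 - \<gamma>)" "1 / (2 - \<gamma>) < 1" using \<gamma> by auto
  then obtain t u where tu:
      "(\<Prod>i\<in>{1..length I}. measure (law i) {..<t} + u * measure (law i) {t}) = 1 / (2 - \<gamma>)"
    by (rule ex_quantile)
  \<comment> \<open>Without atoms the interpolation between left limit and value is constant in
    \<open>u\<close>, so the quantile needs no tie-breaking.\<close>
  have "(\<Prod>i\<in>{1..length I}. measure (law i) {..t})
      = (\<Prod>i\<in>{1..length I}. measure (law i) {..<t} + u * measure (law i) {t})"
  proof (rule prod.cong)
    fix i assume i: "i \<in> {1..length I}"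
    interpret real_distribution "law i" by (rule real_distribution_law[OF i])
    have 0: "measure (law i) {t} = 0"
      using I law_in_set[OF i] by (auto simp: continuous_instance_def)
    have "measure (law i) ({..<t} \<union> {t}) = measure (law i) {..<t} + measure (law i) {t}"
      by (rule finite_measure_Union) auto
    moreover have "{..<t} \<union> {t} = {..t}" by auto
    ultimately show "measure (law i) {..t} = measure (law i) {..<t} + u * measure (law i) {t}"
      by (simp add: 0)
  qed simp
  then have "balanced_threshold \<gamma> I (ereal t)"
    by (simp add: balanced_threshold_def prob_max_value_le tu)
  then show ?thesis ..
qed

end

section \<open>Hard instances\<close>

context seeded_prophet
begin

text \<open>The event of stopping at once is pulled back along \<open>r\<close>, which forgets all
  values but the first. Its indicator must be replaced by a representative \<open>f\<close>, since
  \<open>\<tau>\<close> is unconstrained outside \<open>space joint\<close> while the invariance is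
  wanted at every point.\<close>

lemma first_step_history:
  assumes \<tau>: "stopping_rule S I \<tau>" and i: "2 \<le> i"
  obtains f :: "'s \<times> (nat \<Rightarrow> real) \<Rightarrow> real" where
    "f \<in> borel_measurable joint"
    "\<And>\<omega>. \<omega> \<in> space joint \<Longrightarrow> f \<omega> = of_bool (\<tau> \<omega> \<le> 1)"
    "\<And>\<omega>. f \<omega> \<in> {0, 1}"
    "\<And>s x y. f (s, x(i := y)) = f (s, x)"
proof -
  let ?N = "S \<Otimes>\<^sub>M value_space (take 1 I)"
  have len: "length (take 1 I) = 1" using length_pos by simp
  define r where "r = (\<lambda>(s :: 's, x). (s, restrict x {1..length (take 1 I)} :: nat \<Rightarrow> real))"
  have V1: "value_space (take 1 I) = Pi\<^sub>M {1..1} ext_law"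
    unfolding value_space_def len using length_pos
    by (intro PiM_cong) (auto simp: ext_law_def)
  have "(\<lambda>x. restrict x {1..1}) \<in> value_space I \<rightarrow>\<^sub>M value_space (take 1 I)"
    unfolding V1 value_space_eq using length_pos by (intro measurable_restrict_subset) auto
  then have r_meas: "r \<in> joint \<rightarrow>\<^sub>M ?N"
    unfolding r_def len by (simp add: case_prod_beta')
  have "{\<omega> \<in> space joint. \<tau> \<omega> \<le> 1} \<in> sets (history S I 1)"
    using \<tau> by (auto simp: stopping_rule_def stopping_time_def pred_def history_def)
  moreover have "sets (history S I 1) = {r -` B \<inter> space joint |B. B \<in> sets ?N}"
    unfolding history_def r_def[symmetric]
    by (rule sets_vimage_algebra2) (use measurable_space[OF r_meas] in auto)
  ultimately obtain B where B: "B \<in> sets ?N" "{\<omega> \<in> space joint. \<tau> \<omega> \<le> 1} = r -` B \<inter> space joint"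
    by auto
  show ?thesis
  proof (rule that[of "\<lambda>\<omega>. indicator B (r \<omega>)"])
    show "(\<lambda>\<omega>. indicator B (r \<omega>)) \<in> borel_measurable joint"
      by (rule measurable_compose[OF r_meas]) (use B in simp)
    show "indicator B (r \<omega>) = of_bool (\<tau> \<omega> \<le> 1)" if "\<omega> \<in> space joint" for \<omega>
      using B(2) that by (auto simp: indicator_def)
    show "indicator B (r (s, x(i := y))) = indicator B (r (s, x))" for s x y
    proof -
      have "r (s, x(i := y)) = r (s, x)" using i by (auto simp: r_def restrict_def)
      then show ?thesis by simp
    qed
  qed (auto simp: indicator_def)
qed

text \<open>Whether to stop at the first of two values is decided independently of the second.\<close>

lemma two_values_reward_le:
  assumes \<gamma>: "0 \<le> \<gamma>" "\<gamma> \<le> 1" and \<tau>: "stopping_rule S I \<tau>" and I: "I = [F, G]"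
    and F: "AE y in F. y \<le> 1" and K: "1 \<le> K" "(\<integral>y. max y \<gamma> \<partial>G) \<le> K"
  shows "(\<integral>\<omega>. reward \<gamma> I (\<tau> \<omega>) (snd \<omega>) \<partial>joint) \<le> K"
proof -
  have J: "{1..length I} = {1, 2}" using I by auto
  have law: "law 1 = F" "law 2 = G" "I ! Suc 0 = G" by (simp_all add: I)
  obtain f :: "'s \<times> (nat \<Rightarrow> real) \<Rightarrow> real" where f [measurable]: "f \<in> borel_measurable joint"
    and f_eq: "\<And>\<omega>. \<omega> \<in> space joint \<Longrightarrow> f \<omega> = of_bool (\<tau> \<omega> \<le> 1)"
    and f01: "\<And>\<omega>. f \<omega> \<in> {0, 1}" and inv: "\<And>s x y. f (s, x(2 := y)) = f (s, x)"
    by (rule first_step_history[OF \<tau> order_refl]) blast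
  have f01': "0 \<le> f \<omega>" "f \<omega> \<le> 1" for \<omega> using f01[of \<omega>] by auto
  \<comment> \<open>Since \<open>X_1 \<le> 1\<close>, a rule that passes the first value ends up
    with at most \<open>max X_2 \<gamma>\<close>, whether or not it takes the second.\<close>
  let ?g = "\<lambda>y. max y \<gamma>"
  interpret G: real_distribution G using real_distribution_law[of 2] J law by simp
  have int_g: "integrable (law 2) ?g"
    using integrable_law[of 2] J law by auto
  have int_f: "integrable joint f"
    by (rule joint.integrable_const_bound[where B=1]) (use f01' in auto)
  have int_rest: "integrable joint (\<lambda>\<omega>. (1 - f \<omega>) * ?g (snd \<omega> 2))"
    and E_rest: "(\<integral>\<omega>. (1 - f \<omega>) * ?g (snd \<omega> 2) \<partial>joint) = (\<integral>\<omega>. 1 - f \<omega> \<partial>joint) * (\<integral>y. ?g y \<partial>law 2)"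
    by (rule integrable_coord_indep integral_coord_indep;
        use int_g J f01' inv \<gamma> in \<open>simp add: le_max_iff_disj\<close>)+
  define p where "p = (\<integral>\<omega>. f \<omega> \<partial>joint)"
  have p: "0 \<le> p" "p \<le> 1"
    unfolding p_def using f01' joint.integral_le_const[OF int_f] by auto
  have "(\<integral>\<omega>. reward \<gamma> I (\<tau> \<omega>) (snd \<omega>) \<partial>joint) \<le> (\<integral>\<omega>. f \<omega> + (1 - f \<omega>) * ?g (snd \<omega> 2) \<partial>joint)"
  \<comment> \<open>The nonnegative majorant takes the place of integrability of the reward: the
    integral of a non-integrable function is 0, hence below it as well.\<close>
  proof (rule integral_mono_AE')
    show "integrable joint (\<lambda>\<omega>. f \<omega> + (1 - f \<omega>) * ?g (snd \<omega> 2))"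
      by (rule Bochner_Integration.integrable_add[OF int_f int_rest])
    show "AE \<omega> in joint. 0 \<le> f \<omega> + (1 - f \<omega>) * ?g (snd \<omega> 2)"
      using f01' \<gamma> by (intro always_eventually allI add_nonneg_nonneg mult_nonneg_nonneg) (auto simp: le_max_iff_disj)
    have "AE \<omega> in joint. snd \<omega> 1 \<le> 1" 
      by (rule AE_coord[of 1 "\<lambda>y. y \<le> 1", unfolded law, OF _ F]) (simp add: J)
    with AE_nonneg AE_space show "AE \<omega> in joint. reward \<gamma> I (\<tau> \<omega>) (snd \<omega>) \<le> f \<omega> + (1 - f \<omega>) * ?g (snd \<omega> 2)"
    proof eventually_elim
      case (elim \<omega>)
      let ?x = "snd \<omega>"
      have x: "0 \<le> ?x 1" "0 \<le> ?x 2" "?x 1 \<le> 1" using elim J by auto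
      have le: "\<gamma> * ?x 1 \<le> \<gamma>" "\<gamma> * ?x 2 \<le> ?x 2"
        using x \<gamma> by (simp_all add: mult_left_le mult_left_le_one_le)
      have "\<tau> \<omega> \<in> {1..3}" using \<tau> elim(2) by (auto simp: stopping_rule_def I)
      then consider "\<tau> \<omega> = 1" | "\<tau> \<omega> = 2" | "\<tau> \<omega> = 3" by force
      then show ?case
      proof cases
        case 1
        then show ?thesis using x f_eq[OF elim(2)] by (simp add: reward_def I)
      next
        case 2
        have "{1..<2::nat} = {1}" by auto
        then show ?thesis using 2 le f_eq[OF elim(2)] by (simp add: reward_def I max_def)
      next
        case 3
        have "reward \<gamma> I 3 ?x = \<gamma> * max (?x 1) (?x 2)"
          unfolding reward_def max_value_def J by (simp add: I)
        then show ?thesis using 3 le f_eq[OF elim(2)] by (simp add: max_def)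
      qed
    qed
  qed
  also have "\<dots> = p + (1 - p) * (\<integral>y. ?g y \<partial>G)"
    using int_f by (simp add: Bochner_Integration.integral_add[OF int_f int_rest] E_rest p_def law joint.prob_space)
  \<comment> \<open>The bound is a convex combination of 1 and the mean of
    \<open>max X_2 \<gamma>\<close>, both at most \<open>K\<close>.\<close>
  also have "\<dots> \<le> p * K + (1 - p) * K"
    using p K by (intro add_mono mult_left_mono) (auto simp: mult_left_le mult_le_cancel_left1)
  finally show ?thesis by (simp add: algebra_simps)
qed

text \<open>With \<open>y = sqrt X_2\<close> the claim is the expectation of
  \<open>x + y\<^sup>2 - y \<le> max x (y\<^sup>2)\<close>. If \<open>y \<le> 1\<close> then
  \<open>y\<^sup>2 \<le> y\<close>; otherwise \<open>x \<le> 1 < y\<close>. This makes the maximum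
  additive at the price of the mean of \<open>sqrt\<close>.\<close>

lemma two_values_opt_ge:
  assumes I: "I = [F, G]" and F: "AE y in F. l \<le> y \<and> y \<le> 1" and G: "integrable G sqrt"
  shows "l + (\<integral>y. y \<partial>G) - (\<integral>y. sqrt y \<partial>G) \<le> opt I"
proof -
  have J: "{1..length I} = {1, 2}" using I by auto
  have law: "law 1 = F" "law 2 = G" "I ! Suc 0 = G" by (simp_all add: I)
  have 2: "2 \<in> {1..length I}" using J by simp
  have int: "integrable joint (\<lambda>\<omega>. snd \<omega> 2)" by (rule integrable_coord[OF 2])
  have int_sqrt: "integrable joint (\<lambda>\<omega>. sqrt (snd \<omega> 2))"
    using integrable_coord_iff[OF 2, of sqrt] G law by simp
  have "l + (\<integral>y. y \<partial>G) - (\<integral>y. sqrt y \<partial>G) = (\<integral>\<omega>. l + snd \<omega> 2 - sqrt (snd \<omega> 2) \<partial>joint)"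
    using integral_coord[OF 2, of "\<lambda>y. y"] integral_coord[OF 2, of sqrt] int int_sqrt
    by (simp add: law joint.prob_space)
  also have "\<dots> \<le> opt I"
    unfolding opt_eq
  proof (rule integral_mono_AE)
    show "integrable joint (\<lambda>\<omega>. l + snd \<omega> 2 - sqrt (snd \<omega> 2))" using int int_sqrt by simp
    show "integrable joint (\<lambda>\<omega>. max_value I (snd \<omega>))" by (rule integrable_max_value)
    have "AE \<omega> in joint. l \<le> snd \<omega> 1 \<and> snd \<omega> 1 \<le> 1"
      by (rule AE_coord[of 1 "\<lambda>y. l \<le> y \<and> y \<le> 1", unfolded law, OF _ F]) (simp add: J)
    with AE_nonneg show "AE \<omega> in joint. l + snd \<omega> 2 - sqrt (snd \<omega> 2) \<le> max_value I (snd \<omega>)"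
    proof eventually_elim
      case (elim \<omega>)
      define x y where "x = snd \<omega> 1" "y = sqrt (snd \<omega> 2)"
      have xy: "l \<le> x" "x \<le> 1" "0 \<le> y" "snd \<omega> 2 = y\<^sup>2" using elim J by (auto simp: x_y_def)
      have "max_value I (snd \<omega>) = max x (y\<^sup>2)"
        unfolding max_value_def J by (simp add: x_y_def(1) xy(4))
      moreover have "x + y\<^sup>2 - y \<le> max x (y\<^sup>2)"
      proof (cases "y \<le> 1")
        case True
        then have "y\<^sup>2 \<le> y" using xy by (simp add: power2_eq_square mult_left_le)
        then show ?thesis by simp
      qed (use xy in simp)
      ultimately show ?case using xy by simp
    qed
  qed
  finally show ?thesis .
qed

end

section \<open>Laws without atoms from powers of a uniform variable\<close>

lemma unit_uniform_eq_density: "unit_uniform = density lborel (\<lambda>x. ennreal (indicator {0..1} x))"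
  unfolding uniform_measure_def by (intro density_cong) (auto simp: indicator_def)

lemma
  shows integrable_unit_uniform_power: "integrable unit_uniform (\<lambda>x. c * x ^ k)"
    and integral_unit_uniform_power: "(\<integral>x. c * x ^ k \<partial>unit_uniform) = c / (real k + 1)"
proof -
  have "has_bochner_integral lborel (\<lambda>x. x ^ k * indicator {0..1} x :: real)
      (1 ^ Suc k / Suc k - 0 ^ Suc k / Suc k)"
  proof (rule has_bochner_integral_FTC_Icc_real)
    show "DERIV (\<lambda>x. x ^ Suc k / Suc k) x :> x ^ k" for x :: real
      by (intro derivative_eq_intros) auto
  qed auto
  then have 1: "has_bochner_integral lborel (\<lambda>x. indicator {0..1} x *\<^sub>R x ^ k :: real) (1 / (real k + 1))"
    by (simp add: mult.commute add.commute)
  have "has_bochner_integral unit_uniform (\<lambda>x. x ^ k) (1 / (real k + 1))"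
    unfolding unit_uniform_eq_density
    by (rule has_bochner_integral_density) (use 1 in auto)
  then have "has_bochner_integral unit_uniform (\<lambda>x. c * x ^ k) (c * (1 / (real k + 1)))"
    by (rule has_bochner_integral_mult_right)
  then show "integrable unit_uniform (\<lambda>x. c * x ^ k)" "(\<integral>x. c * x ^ k \<partial>unit_uniform) = c / (real k + 1)"
    by (auto simp: has_bochner_integral_iff)
qed

lemma AE_unit_uniform: "AE x in unit_uniform. 0 \<le> x \<and> x \<le> 1"
  by (rule AE_uniform_measureI) auto

text \<open>Injectivity leaves at most one point of \<open>{0..1}\<close> in the preimage of
  \<open>x\<close>, a Lebesgue null set.\<close>

lemma measure_distr_unit_uniform_singleton:
  fixes g :: "real \<Rightarrow> real"
  assumes g: "g \<in> borel_measurable borel" and inj: "inj_on g {0..1}"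
  shows "measure (distr unit_uniform borel g) {x} = 0"
proof -
  have g': "g \<in> borel_measurable unit_uniform"
    using g by (simp add: measurable_cong_sets[OF sets_uniform_measure refl])
  have "finite {u \<in> {0..1}. g u = x}"
    using finite_vimage_IntI[OF _ inj, of "{x}"] by (rule finite_subset[rotated]) auto
  then have "emeasure lborel ({0..1} \<inter> g -` {x}) = 0"
    by (intro emeasure_lborel_countable countable_finite) (rule finite_subset[rotated], auto)
  moreover have "g -` {x} \<in> sets borel" using measurable_sets[OF g, of "{x}"] by simp
  ultimately have "emeasure unit_uniform (g -` {x}) = 0" by simp
  then show ?thesis by (subst measure_distr[OF g']) (auto simp: measure_def)
qed

lemma real_distribution_distr_unit_uniform:
  assumes "g \<in> borel_measurable borel"
  shows "real_distribution (distr unit_uniform borel g)"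
  using assms by (intro prob_space.real_distribution_distr[OF prob_space_unit_uniform])
    (simp add: measurable_cong_sets[OF sets_uniform_measure refl])

text \<open>The summand 1 in the coefficient of \<open>v\<^sup>2\<^sup>m\<close> keeps the law without atoms for \<open>\<gamma> = 1\<close>; otherwise the mean
  of \<open>X\<^sub>2\<close> would be exactly \<open>1 - \<gamma>\<close>.\<close>

definition hard_instance :: "real \<Rightarrow> nat \<Rightarrow> real measure list" where
  "hard_instance \<gamma> m = [distr unit_uniform borel (\<lambda>v. 1 - v / (real m + 1)),
     distr unit_uniform borel (\<lambda>v. (1 + (1 - \<gamma>) * (2 * real m + 1)) * v ^ (2 * m))]"

lemma continuous_hard_instance:
  assumes \<gamma>: "0 \<le> \<gamma>" "\<gamma> \<le> 1" and m: "1 \<le> m"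
  shows "continuous_instance (hard_instance \<gamma> m)"
proof -
  define c where "c = 1 + (1 - \<gamma>) * (2 * real m + 1)"
  have c: "1 \<le> c" using \<gamma> by (simp add: c_def)
  let ?g = "\<lambda>v. 1 - v / (real m + 1)" and ?h = "\<lambda>v. c * v ^ (2 * m) :: real"
  have g: "?g \<in> borel_measurable borel" and h: "?h \<in> borel_measurable borel" by measurable
  have g': "?g \<in> borel_measurable unit_uniform" and h': "?h \<in> borel_measurable unit_uniform"
    using g h by (simp_all add: measurable_cong_sets[OF sets_uniform_measure refl])
  have "inj_on ?g {0..1}" by (auto simp: inj_on_def)
  \<comment> \<open>Both conditions matter: \<open>1 \<le> c\<close> keeps the function from
    vanishing, and \<open>1 \<le> m\<close> keeps the power from being constant.\<close>
  moreover have "inj_on ?h {0..1}"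
  proof (rule inj_onI)
    fix x y :: real assume xy: "x \<in> {0..1}" "y \<in> {0..1}" "c * x ^ (2 * m) = c * y ^ (2 * m)"
    then show "x = y" using c m power_eq_imp_eq_base[of x "2 * m" y] by auto
  qed
  moreover have "AE y in distr unit_uniform borel ?g. 0 \<le> y"
  proof (subst AE_distr_iff[OF g'])
    show "AE v in unit_uniform. 0 \<le> ?g v"
      using AE_unit_uniform by eventually_elim (simp add: divide_le_eq)
  qed simp
  moreover have "AE y in distr unit_uniform borel ?h. 0 \<le> y"
  proof (subst AE_distr_iff[OF h'])
    show "AE v in unit_uniform. 0 \<le> ?h v"
      using AE_unit_uniform by eventually_elim (use c in simp)
  qed simp
  moreover have "integrable unit_uniform ?g"
  proof -
    interpret prob_space unit_uniform by (rule prob_space_unit_uniform)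
    show ?thesis using integrable_unit_uniform_power[of "1 / (real m + 1)" 1] by simp
  qed
  then have "integrable (distr unit_uniform borel ?g) (\<lambda>y. y)"
    by (subst integrable_distr_eq[OF g']) auto
  moreover have "integrable (distr unit_uniform borel ?h) (\<lambda>y. y)"
    by (subst integrable_distr_eq[OF h']) (simp, rule integrable_unit_uniform_power)
  ultimately show ?thesis
    using real_distribution_distr_unit_uniform[OF g] real_distribution_distr_unit_uniform[OF h]
      measure_distr_unit_uniform_singleton[OF g] measure_distr_unit_uniform_singleton[OF h]
    by (simp add: continuous_instance_def prophet_instance_def hard_instance_def c_def[symmetric])
qed

text \<open>\<open>X_2\<close> has mean
  \<open>c / (2 * m + 1) = 1 - \<gamma> + 1 / (2 * m + 1)\<close>, which gives the surplus in the
  reward bound. The mean of its root is \<open>sqrt c / (m + 1)\<close>; with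
  \<open>c \<le> 2 * m + 2\<close> this is the last error term of the optimum, the other one being
  the gap between \<open>X_1\<close> and 1.\<close>

lemma hard_instance_bounds:
  fixes A :: "'s algorithm"
  assumes \<gamma>: "0 \<le> \<gamma>" "\<gamma> \<le> 1" and m: "1 \<le> m" and A: "online_algorithm A"
  shows "expected_reward \<gamma> A (hard_instance \<gamma> m) \<le> 1 + 1 / (2 * real m + 1)"
    and "2 - \<gamma> - 1 / (real m + 1) - sqrt (2 * real m + 2) / (real m + 1) \<le> opt (hard_instance \<gamma> m)"
proof -
  define c where "c = 1 + (1 - \<gamma>) * (2 * real m + 1)"
  have "(1 - \<gamma>) * (2 * real m + 1) \<le> 2 * real m + 1"
    using \<gamma> by (intro mult_left_le_one_le) auto
  then have c2: "c \<le> 2 * real m + 2" unfolding c_def by linarith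
  have c: "1 \<le> c" using \<gamma> by (simp add: c_def)
  let ?g = "\<lambda>v. 1 - v / (real m + 1)" and ?h = "\<lambda>v. c * v ^ (2 * m) :: real"
  define F G where "F = distr unit_uniform borel ?g" "G = distr unit_uniform borel ?h"
  have g': "?g \<in> borel_measurable unit_uniform" and h': "?h \<in> borel_measurable unit_uniform"
    by (simp_all add: measurable_cong_sets[OF sets_uniform_measure refl])
  define I where "I = hard_instance \<gamma> m"
  have I: "I = [F, G]" by (simp add: I_def hard_instance_def F_G_def c_def)
  have "prophet_instance I"
    using continuous_hard_instance[OF \<gamma> m] by (simp add: I_def continuous_instance_def)
  then interpret seeded_prophet I "fst (A I)"
    using A by (auto simp: seeded_prophet_def prophet_def online_algorithm_def)
  have \<tau>: "stopping_rule (fst (A I)) I (snd (A I))"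
    using A \<open>prophet_instance I\<close> by (auto simp: online_algorithm_def)
  have F: "AE y in F. 1 - 1 / (real m + 1) \<le> y \<and> y \<le> 1"
    unfolding F_G_def
  proof (subst AE_distr_iff[OF g'])
    show "AE v in unit_uniform. 1 - 1 / (real m + 1) \<le> ?g v \<and> ?g v \<le> 1"
      using AE_unit_uniform by eventually_elim (simp add: divide_right_mono)
  qed simp
  have E_G: "(\<integral>y. y \<partial>G) = 1 - \<gamma> + 1 / (2 * real m + 1)"
  proof -
    have "(\<integral>y. y \<partial>G) = (\<integral>v. ?h v \<partial>unit_uniform)"
      unfolding F_G_def by (rule integral_distr[OF h']) simp
    also have "\<dots> = c / (2 * real m + 1)"
      unfolding integral_unit_uniform_power by simp
    finally have "(\<integral>y. y \<partial>G) = c / (2 * real m + 1)" .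
    then show ?thesis by (simp add: c_def field_simps)
  qed
  \<comment> \<open>Almost surely only: the root of an even power is the half power just for
    \<open>v \<ge> 0\<close>.\<close>
  have AE_sqrt: "AE v in unit_uniform. sqrt c * v ^ m = sqrt (?h v)"
    using AE_unit_uniform
  proof eventually_elim
    case (elim v)
    then show ?case by (simp add: real_sqrt_mult power_even_eq power_mult real_sqrt_power)
  qed
  have sqrt_meas: "(\<lambda>v. sqrt (?h v)) \<in> borel_measurable unit_uniform"
    by (simp add: measurable_cong_sets[OF sets_uniform_measure refl])
  have int_sqrt: "integrable G sqrt"
    unfolding F_G_def
  proof (subst integrable_distr_eq[OF h'])
    show "integrable unit_uniform (\<lambda>v. sqrt (?h v))"
      using integrable_cong_AE_imp[OF integrable_unit_uniform_power sqrt_meas AE_sqrt] .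
  qed simp
  have E_sqrt: "(\<integral>y. sqrt y \<partial>G) = sqrt c / (real m + 1)"
  proof -
    have "(\<integral>y. sqrt y \<partial>G) = (\<integral>v. sqrt (?h v) \<partial>unit_uniform)"
      unfolding F_G_def by (rule integral_distr[OF h']) simp
    also have "\<dots> = (\<integral>v. sqrt c * v ^ m \<partial>unit_uniform)"
      by (rule integral_cong_AE) (use AE_sqrt sqrt_meas in
        \<open>auto simp: measurable_cong_sets[OF sets_uniform_measure refl] elim: eventually_mono\<close>)
    also have "\<dots> = sqrt c / (real m + 1)" by (rule integral_unit_uniform_power)
    finally show ?thesis .
  qed
  have "1 - 1 / (real m + 1) + (\<integral>y. y \<partial>G) - (\<integral>y. sqrt y \<partial>G) \<le> opt I"
    by (rule two_values_opt_ge[OF I F int_sqrt])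
  moreover have "sqrt c / (real m + 1) \<le> sqrt (2 * real m + 2) / (real m + 1)"
    using c2 by (intro divide_right_mono) auto
  moreover have "0 \<le> 1 / (2 * real m + 1)" by simp
  ultimately show "2 - \<gamma> - 1 / (real m + 1) - sqrt (2 * real m + 2) / (real m + 1) \<le> opt (hard_instance \<gamma> m)"
    unfolding E_G E_sqrt I_def[symmetric] by linarith

  have "(\<integral>\<omega>. reward \<gamma> I (snd (A I) \<omega>) (snd \<omega>) \<partial>joint) \<le> 1 + 1 / (2 * real m + 1)"
  proof (rule two_values_reward_le[OF \<gamma> \<tau> I])
    show "AE y in F. y \<le> 1" using F by eventually_elim simp
    have "G \<in> set I" by (simp add: I)
    then have intG: "integrable G (\<lambda>y. y)" and posG: "AE y in G. 0 \<le> y" and "prob_space G"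
      using \<open>prophet_instance I\<close> by (auto simp: prophet_instance_def real_distribution_def)
    interpret G: prob_space G by fact
    \<comment> \<open>Replacing the maximum by the sum costs nothing in the limit, as the mean
      \<open>1 - \<gamma> + 1 / (2 * m + 1)\<close> leaves just room for
      \<open>\<gamma>\<close>.\<close>
    have "(\<integral>y. max y \<gamma> \<partial>G) \<le> (\<integral>y. y + \<gamma> \<partial>G)"
      by (rule integral_mono_AE) (use intG posG \<gamma> in \<open>auto elim!: eventually_mono\<close>)
    also have "\<dots> = 1 + 1 / (2 * real m + 1)"
      using intG E_G by (simp add: G.prob_space)
    finally show "(\<integral>y. max y \<gamma> \<partial>G) \<le> 1 + 1 / (2 * real m + 1)" .
  qed simp
  then show "expected_reward \<gamma> A (hard_instance \<gamma> m) \<le> 1 + 1 / (2 * real m + 1)"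
    by (simp add: expected_reward_def I_def)
qed

section \<open>From single instances to the infimum\<close>

lemma expected_reward_nonneg:
  assumes "0 \<le> \<gamma>" "online_algorithm A" "prophet_instance I"
  shows "0 \<le> expected_reward \<gamma> A I"
proof -
  interpret seeded_prophet I "fst (A I)"
    using assms by (auto simp: seeded_prophet_def prophet_def online_algorithm_def)
  have \<tau>: "snd (A I) \<in> space joint \<rightarrow> {1..length I + 1}"
    using assms by (auto simp: online_algorithm_def stopping_rule_def)
  show ?thesis
    unfolding expected_reward_def
  proof (rule integral_nonneg_AE)
    show "AE \<omega> in joint. 0 \<le> reward \<gamma> I (snd (A I) \<omega>) (snd \<omega>)"
      using AE_nonneg AE_space
    proof eventually_elim
      case (elim \<omega>)
      then show ?case
        using \<tau> assms length_pos by (intro reward_nonneg) auto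
    qed
  qed
qed

text \<open>Places the hard instances, for large \<open>m\<close>, among those over which the
  infimum in \<open>competitive_ratio\<close> is taken.\<close>

lemma eventually_hard_instance_opt_pos:
  assumes \<gamma>: "0 \<le> \<gamma>" "\<gamma> \<le> 1"
  shows "\<forall>\<^sub>F m in sequentially. 0 < 2 - \<gamma> - 1 / (real m + 1) - sqrt (2 * real m + 2) / (real m + 1)"
proof -
  have "(\<lambda>m. 2 - \<gamma> - 1 / (real m + 1) - sqrt (2 * real m + 2) / (real m + 1)) \<longlonglongrightarrow> 2 - \<gamma>"
    by real_asymp
  then show ?thesis using \<gamma> by (intro order_tendstoD(1)) auto
qed

text \<open>The infimum is below the ratio of every hard instance and hence below their limit. As
  these instances are continuous, the class \<open>\<I>\<close> may be anything between the
  continuous and all instances, which serves both algorithms.\<close>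

lemma competitive_ratio_le:
  fixes A :: "'s algorithm"
  assumes \<gamma>: "0 \<le> \<gamma>" "\<gamma> \<le> 1" and A: "online_algorithm A"
    and \<I>: "{I. continuous_instance I} \<subseteq> \<I>" "\<I> \<subseteq> {I. prophet_instance I}"
  shows "competitive_ratio \<gamma> \<I> A \<le> 1 / (2 - \<gamma>)"
proof -
  let ?d = "\<lambda>m. 2 - \<gamma> - 1 / (real m + 1) - sqrt (2 * real m + 2) / (real m + 1)"
  \<comment> \<open>An infimum of reals lies below its members only if they are bounded below;
    nonnegative rewards provide this for an arbitrary rule.\<close>
  have bdd: "bdd_below ((\<lambda>I. expected_reward \<gamma> A I / opt I) ` {I \<in> \<I>. 0 < opt I})"
    using expected_reward_nonneg[OF \<gamma>(1) A] \<I> by (intro bdd_belowI[of _ 0]) auto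
  have d: "?d \<longlonglongrightarrow> 2 - \<gamma>" by real_asymp
  have "(\<lambda>m. (1 + 1 / (2 * real m + 1)) / ?d m) \<longlonglongrightarrow> 1 / (2 - \<gamma>)"
    by (rule tendsto_divide[OF _ d]) (use \<gamma> in \<open>real_asymp | simp\<close>)+
  moreover have "\<forall>\<^sub>F m in sequentially. competitive_ratio \<gamma> \<I> A \<le> (1 + 1 / (2 * real m + 1)) / ?d m"
    using eventually_hard_instance_opt_pos[OF \<gamma>] eventually_ge_at_top[of 1]
  proof eventually_elim
    case (elim m)
    let ?I = "hard_instance \<gamma> m"
    note bounds = hard_instance_bounds[OF \<gamma> elim(2) A]
    have "competitive_ratio \<gamma> \<I> A \<le> expected_reward \<gamma> A ?I / opt ?I"
      unfolding competitive_ratio_def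
      using continuous_hard_instance[OF \<gamma> elim(2)] \<I> elim(1) bounds(2)
      by (intro cINF_lower[OF bdd]) auto
    also have "\<dots> \<le> (1 + 1 / (2 * real m + 1)) / ?d m"
      using bounds elim(1) by (intro frac_le) auto
    finally show ?case .
  qed
  ultimately show ?thesis by (rule tendsto_lowerbound) simp
qed

text \<open>The guarantee per instance passes to the infimum once some instance has positive
  optimum, since an infimum over the empty set of reals would say nothing; a hard instance is the
  witness.\<close>

lemma competitive_ratio_ge:
  fixes A :: "'s algorithm"
  assumes \<gamma>: "0 \<le> \<gamma>" "\<gamma> \<le> 1" and A: "online_algorithm A"
    and \<I>: "{I. continuous_instance I} \<subseteq> \<I>"
    and ge: "\<And>I. I \<in> \<I> \<Longrightarrow> opt I / (2 - \<gamma>) \<le> expected_reward \<gamma> A I"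
  shows "1 / (2 - \<gamma>) \<le> competitive_ratio \<gamma> \<I> A"
  unfolding competitive_ratio_def
proof (rule cINF_greatest)
  obtain m :: nat where m: "1 \<le> m" "0 < 2 - \<gamma> - 1 / (real m + 1) - sqrt (2 * real m + 2) / (real m + 1)"
    using eventually_happens[OF eventually_conj[OF eventually_ge_at_top[of 1] eventually_hard_instance_opt_pos[OF \<gamma>]]]
    by auto
  then have "hard_instance \<gamma> m \<in> {I \<in> \<I>. 0 < opt I}"
    using continuous_hard_instance[OF \<gamma> m(1)] hard_instance_bounds(2)[OF \<gamma> m(1) A] \<I> by auto
  then show "{I \<in> \<I>. 0 < opt I} \<noteq> {}" by blast
  show "1 / (2 - \<gamma>) \<le> expected_reward \<gamma> A I / opt I" if "I \<in> {I \<in> \<I>. 0 < opt I}" for I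
    using ge[of I] that by (simp add: field_simps)
qed

section \<open>Competitive ratio of the threshold algorithms\<close>

lemma online_single_threshold_ties: "online_algorithm (single_threshold_ties \<theta>u)"
  unfolding online_algorithm_def
proof (intro allI impI)
  fix I assume "prophet_instance I"
  then interpret prophet I by unfold_locales
  have "snd (single_threshold_ties \<theta>u I) = marks.stop (\<theta>u I)"
    by (auto simp: single_threshold_ties_def marks.stop_def[abs_def] marks.accepts_def)
  then show "prob_space (fst (single_threshold_ties \<theta>u I)) \<and>
      stopping_rule (fst (single_threshold_ties \<theta>u I)) I (snd (single_threshold_ties \<theta>u I))"
    using marks.stopping_rule_stop[of "\<theta>u I"] prob_space_marks by (simp add: single_threshold_ties_def)
qed

lemma expected_reward_single_threshold_ties:
  assumes \<gamma>: "0 \<le> \<gamma>" "\<gamma> \<le> 1" and "prophet_instance I" and bal: "balanced_threshold_ties \<gamma> I (\<theta>u I)"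
  shows "opt I / (2 - \<gamma>) \<le> expected_reward \<gamma> (single_threshold_ties \<theta>u) I"
proof -
  interpret prophet I by unfold_locales fact
  have "snd (single_threshold_ties \<theta>u I) = marks.stop (\<theta>u I)"
    by (auto simp: single_threshold_ties_def marks.stop_def[abs_def] marks.accepts_def)
  then show ?thesis
    using marks.reward_stop_ge[OF \<gamma>, of "\<theta>u I"] bal
    by (simp add: expected_reward_def balanced_threshold_ties_def marks.accepts_def)
      (simp add: single_threshold_ties_def)
qed

abbreviation no_seed :: "unit measure" where
  "no_seed \<equiv> return (count_space UNIV) ()"

text \<open>Constant marks 0 reject every tie when the tie parameter is 0 as well, because
  \<open>0 < 0\<close> fails; this recovers the strict comparison of
  \<open>single_threshold\<close>.\<close>

lemma (in prophet) threshold_rule_no_seed: "threshold_rule I no_seed (\<lambda>_ _. 0)"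
  by (intro threshold_rule.intro seeded_prophet.intro threshold_rule_axioms.intro
    prophet_axioms prob_space_return) auto

lemma online_single_threshold: "online_algorithm (single_threshold \<theta>)"
  unfolding online_algorithm_def
proof (intro allI impI)
  fix I assume "prophet_instance I"
  then interpret prophet I by unfold_locales
  interpret threshold_rule I no_seed "\<lambda>_ _. 0" "(\<theta> I, 0)" by (rule threshold_rule_no_seed)
  have "snd (single_threshold \<theta> I) = stop"
    by (auto simp: single_threshold_def stop_def[abs_def] accepts_def exceeds_def)
  then show "prob_space (fst (single_threshold \<theta> I)) \<and>
      stopping_rule (fst (single_threshold \<theta> I)) I (snd (single_threshold \<theta> I))"
    using stopping_rule_stop S.prob_space_axioms by (simp add: single_threshold_def)
qed

lemma expected_reward_single_threshold:
  assumes \<gamma>: "0 \<le> \<gamma>" "\<gamma> \<le> 1" and "prophet_instance I" and bal: "balanced_threshold \<gamma> I (\<theta> I)"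
  shows "opt I / (2 - \<gamma>) \<le> expected_reward \<gamma> (single_threshold \<theta>) I"
proof -
  interpret prophet I by unfold_locales fact
  interpret threshold_rule I no_seed "\<lambda>_ _. 0" "(\<theta> I, 0)" by (rule threshold_rule_no_seed)
  have stop: "snd (single_threshold \<theta> I) = stop"
    by (auto simp: single_threshold_def stop_def[abs_def] accepts_def exceeds_def)
  \<comment> \<open>The balance condition speaks of the maximum under the law of the values; this
    equivalence and \<open>prob_snd\<close> turn it into the event on \<open>joint\<close> that
    \<open>reward_stop_ge\<close> asks for.\<close>
  have none: "(\<forall>i\<in>{1..length I}. \<not> accepts i \<omega>) \<longleftrightarrow> ereal (max_value I (snd \<omega>)) \<le> \<theta> I" for \<omega>
  proof -
    have "max_value I (snd \<omega>) \<in> snd \<omega> ` {1..length I}"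
      unfolding max_value_def using length_pos by (intro Max_in) auto
    moreover have "snd \<omega> i \<le> max_value I (snd \<omega>)" if "i \<in> {1..length I}" for i
      unfolding max_value_def using that by (intro Max_ge) auto
    ultimately show ?thesis
      by (auto simp: accepts_def exceeds_def not_less intro: order_trans[rotated])
  qed
  have pred: "Measurable.pred (value_space I) (\<lambda>x. ereal (max_value I x) \<le> \<theta> I)"
    unfolding pred_def by (intro borel_measurable_le borel_measurable_ereal measurable_max_value borel_measurable_const)
  have "\<P>(\<omega> in joint. \<forall>i\<in>{1..length I}. \<not> accepts i \<omega>) = 1 / (2 - \<gamma>)"
    using bal unfolding none prob_snd[OF pred] balanced_threshold_def .
  from reward_stop_ge[OF \<gamma> this] show ?thesis
    by (simp add: expected_reward_def stop) (simp add: single_threshold_def)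
qed

theorem theorem2:
  fixes \<gamma> :: real
  assumes "0 \<le> \<gamma>" and "\<gamma> \<le> 1"
  shows "(\<forall>A :: 's algorithm. online_algorithm A \<longrightarrow>
            competitive_ratio \<gamma> {I. prophet_instance I} A \<le> 1 / (2 - \<gamma>))
    \<and> (\<forall>I. continuous_instance I \<longrightarrow> (\<exists>\<theta>. balanced_threshold \<gamma> I \<theta>))
    \<and> (\<forall>\<theta>. (\<forall>I. continuous_instance I \<longrightarrow> balanced_threshold \<gamma> I (\<theta> I)) \<longrightarrow>
            online_algorithm (single_threshold \<theta>) \<and>
            competitive_ratio \<gamma> {I. continuous_instance I} (single_threshold \<theta>) = 1 / (2 - \<gamma>))
    \<and> (\<forall>I. prophet_instance I \<longrightarrow> (\<exists>\<theta>u. balanced_threshold_ties \<gamma> I \<theta>u))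
    \<and> (\<forall>\<theta>u. (\<forall>I. prophet_instance I \<longrightarrow> balanced_threshold_ties \<gamma> I (\<theta>u I)) \<longrightarrow>
            online_algorithm (single_threshold_ties \<theta>u) \<and>
            competitive_ratio \<gamma> {I. prophet_instance I} (single_threshold_ties \<theta>u) = 1 / (2 - \<gamma>))"
proof -
  note \<gamma> = assms
  have sub: "{I. continuous_instance I} \<subseteq> {I. prophet_instance I}"
    by (auto simp: continuous_instance_def)
  show ?thesis
  proof (intro conjI allI impI)
    show "competitive_ratio \<gamma> {I. prophet_instance I} A \<le> 1 / (2 - \<gamma>)"
      if "online_algorithm A" for A :: "'s algorithm"
      by (rule competitive_ratio_le[OF \<gamma> that sub order_refl])
    show "\<exists>\<theta>. balanced_threshold \<gamma> I \<theta>" if I: "continuous_instance I" for I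
    proof -
      interpret prophet I using I sub by unfold_locales auto
      show ?thesis by (rule ex_balanced_threshold[OF \<gamma> I])
    qed
    show "\<exists>\<theta>u. balanced_threshold_ties \<gamma> I \<theta>u" if I: "prophet_instance I" for I
    proof -
      interpret prophet I using I by unfold_locales
      show ?thesis by (rule ex_balanced_threshold_ties[OF \<gamma>])
    qed
    show online: "online_algorithm (single_threshold \<theta>)" for \<theta> by (rule online_single_threshold)
    show online_ties: "online_algorithm (single_threshold_ties \<theta>u)" for \<theta>u
      by (rule online_single_threshold_ties)
    show "competitive_ratio \<gamma> {I. continuous_instance I} (single_threshold \<theta>) = 1 / (2 - \<gamma>)"
      if bal: "\<forall>I. continuous_instance I \<longrightarrow> balanced_threshold \<gamma> I (\<theta> I)" for \<theta>
    proof (rule antisym)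
      show "competitive_ratio \<gamma> {I. continuous_instance I} (single_threshold \<theta>) \<le> 1 / (2 - \<gamma>)"
        by (rule competitive_ratio_le[OF \<gamma> online order_refl sub])
      show "1 / (2 - \<gamma>) \<le> competitive_ratio \<gamma> {I. continuous_instance I} (single_threshold \<theta>)"
        by (rule competitive_ratio_ge[OF \<gamma> online order_refl])
          (use bal sub in \<open>auto intro: expected_reward_single_threshold[OF \<gamma>]\<close>)
    qed
    show "competitive_ratio \<gamma> {I. prophet_instance I} (single_threshold_ties \<theta>u) = 1 / (2 - \<gamma>)"
      if bal: "\<forall>I. prophet_instance I \<longrightarrow> balanced_threshold_ties \<gamma> I (\<theta>u I)" for \<theta>u
    proof (rule antisym)
      show "competitive_ratio \<gamma> {I. prophet_instance I} (single_threshold_ties \<theta>u) \<le> 1 / (2 - \<gamma>)"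
        by (rule competitive_ratio_le[OF \<gamma> online_ties sub order_refl])
      show "1 / (2 - \<gamma>) \<le> competitive_ratio \<gamma> {I. prophet_instance I} (single_threshold_ties \<theta>u)"
        by (rule competitive_ratio_ge[OF \<gamma> online_ties sub])
          (use bal in \<open>auto intro: expected_reward_single_threshold_ties[OF \<gamma>]\<close>)
    qed
  qed
qed

end
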